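(* Let $k$ be an algebraically closed field of characteristic zero, $R = k[x_1,x_2,x_3,x_4]$ with the standard grading, and let $d \geq 2$ be an integer. Let $F_1,F_2,F_3,F_4 \in R$ be homogeneous forms, all of degree $d$, such that $I = \langle F_1,F_2,F_3,F_4\rangle$ is a complete intersection (i.e. $F_1,\dots,F_4$ is a regular sequence, so $A = R/I$ is artinian). Let $L \in [R]_1$ be a general linear form. Then the multiplication maps $\times L : [A]_{t-1} \rightarrow [A]_t$ are injective for all $t < \left\lfloor \frac{3d+1}{2} \right\rfloor$.
   Context: $[A]_t$ denotes the degree-$t$ homogeneous component of $A$. "For a general linear form $L$" means: for all $L$ in some nonempty Zariski-open subset of $[R]_1$. *)

theory Defs
  imports
    Complex_Main
    "HOL-Library.Poly_Mapping"
    "HOL-Library.Numeral_Type"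
    "HOL-Algebra.QuotRing"
    "HOL-Algebra.Algebraic_Closure_Type"
begin

text \<open>
  Polynomials in variables indexed by \<open>'n\<close>: finitely supported maps from exponent vectors to
  coefficients, with the convolution product that \<open>Poly_Mapping\<close> provides.
\<close>

type_synonym ('n, 'k) mpoly = "('n \<Rightarrow>\<^sub>0 nat) \<Rightarrow>\<^sub>0 'k"

abbreviation mpoly_ring :: "('n, 'k::field) mpoly ring"
  where "mpoly_ring \<equiv> ring_of_type_algebra"

definition mdeg :: "('n::finite \<Rightarrow>\<^sub>0 nat) \<Rightarrow> nat"
  where "mdeg m = (\<Sum>i\<in>UNIV. Poly_Mapping.lookup m i)"

text \<open>
  Grading by the integers, so that \<open>[R]\<^bsub>t\<^esub> = 0\<close> for \<open>t < 0\<close>. The zero polynomial belongs to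
  every component.
\<close>

definition homog_comp :: "int \<Rightarrow> ('n::finite, 'k::field) mpoly set"
  where "homog_comp t = {p. \<forall>m \<in> Poly_Mapping.keys p. int (mdeg m) = t}"

definition quot_comp :: "('n::finite, 'k::field) mpoly set \<Rightarrow> int \<Rightarrow> ('n, 'k) mpoly set set"
  where "quot_comp I t = (\<lambda>p. I +>\<^bsub>mpoly_ring\<^esub> p) ` homog_comp t"

definition mult_map ::
  "('n, 'k::field) mpoly set \<Rightarrow> ('n, 'k) mpoly \<Rightarrow> ('n, 'k) mpoly set \<Rightarrow> ('n, 'k) mpoly set"
  where "mult_map I L a = (I +>\<^bsub>mpoly_ring\<^esub> L) \<otimes>\<^bsub>mpoly_ring Quot I\<^esub> a"

lemma mult_map_coset:
  fixes I :: "('n, 'k::field) mpoly set"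
  assumes "ideal I mpoly_ring"
  shows "mult_map I L (I +>\<^bsub>mpoly_ring\<^esub> p) = I +>\<^bsub>mpoly_ring\<^esub> (L * p)"
  using ideal.rcoset_mult_add[OF assms, of L p]
  by (simp add: mult_map_def FactRing_def ring_of_type_algebra_def)

lemma mdeg_add: "mdeg (m + n) = mdeg m + mdeg n"
  by (simp add: mdeg_def lookup_add sum.distrib)

lemma homog_comp_mult:
  assumes "p \<in> homog_comp s" "q \<in> homog_comp t"
  shows "p * q \<in> homog_comp (s + t)"
  using assms keys_mult[of p q] by (fastforce simp: homog_comp_def mdeg_add)

text \<open>So multiplication by a linear form maps \<open>[A]\<^bsub>t-1\<^esub>\<close> to \<open>[A]\<^bsub>t\<^esub>\<close>:\<close>

lemma mult_map_in_quot_comp: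
  assumes "ideal I mpoly_ring" "L \<in> homog_comp 1" "a \<in> quot_comp I (t - 1)"
  shows "mult_map I L a \<in> quot_comp I t"
  using assms homog_comp_mult[of L 1 _ "t - 1"]
  by (auto simp: quot_comp_def mult_map_coset)

definition regular_sequence :: "('a, 'b) ring_scheme \<Rightarrow> 'a list \<Rightarrow> bool"
  where "regular_sequence R fs \<longleftrightarrow>
    set fs \<subseteq> carrier R \<and>
    (\<forall>i < length fs.
      let J = genideal R (set (take i fs)); Q = R Quot J in
      \<forall>a \<in> carrier Q. (J +>\<^bsub>R\<^esub> (fs ! i)) \<otimes>\<^bsub>Q\<^esub> a = \<zero>\<^bsub>Q\<^esub> \<longrightarrow> a = \<zero>\<^bsub>Q\<^esub>) \<and>
    genideal R (set fs) \<noteq> carrier R"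

definition mpoly_eval :: "('n::finite, 'k::field) mpoly \<Rightarrow> ('n \<Rightarrow> 'k) \<Rightarrow> 'k"
  where "mpoly_eval p v = (\<Sum>m\<in>Poly_Mapping.keys p. Poly_Mapping.lookup p m * (\<Prod>i\<in>UNIV. v i ^ Poly_Mapping.lookup m i))"

definition zariski_closed :: "('n::finite \<Rightarrow> 'k::field) set \<Rightarrow> bool"
  where "zariski_closed V \<longleftrightarrow>
    (\<exists>S :: ('n, 'k) mpoly set. V = {v. \<forall>p\<in>S. mpoly_eval p v = 0})"

text \<open>
  The space of linear forms is identified with affine space through the coefficients of the
  variables.
\<close>

definition linear_coeffs :: "('n, 'k::field) mpoly \<Rightarrow> 'n \<Rightarrow> 'k"
  where "linear_coeffs L i = Poly_Mapping.lookup L (Poly_Mapping.single i 1)"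

definition zariski_open_linear_forms :: "('n::finite, 'k::field) mpoly set \<Rightarrow> bool"
  where "zariski_open_linear_forms U \<longleftrightarrow>
    (\<exists>V. zariski_closed V \<and> U = {L \<in> homog_comp 1. linear_coeffs L \<notin> V})"

definition for_general_linear_form :: "(('n::finite, 'k::field) mpoly \<Rightarrow> bool) \<Rightarrow> bool"
  where "for_general_linear_form P \<longleftrightarrow>
    (\<exists>U. zariski_open_linear_forms U \<and> U \<noteq> {} \<and> (\<forall>L\<in>U. P L))"

end

theory Submission
  imports Defs "Berlekamp_Zassenhaus.Unique_Factorization_Poly"
begin

text \<open>
  An element of the kernel of multiplication by \<open>L\<close> in degree \<open>t\<close> is a non-Koszul syzygy of
  degree \<open>t - d\<close> of the restrictions of \<open>F1, ..., F4\<close> to the plane \<open>L = 0\<close>, so one has to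
  show that on a general plane these forms have no syzygy \<open>g\<close> of degree \<open>e\<close> with
  \<open>2 e + 1 \<le> d\<close>.  Otherwise there is such a \<open>g\<close> depending polynomially on the parameters
  \<open>a\<close> of the plane \<open>x0 = a1 x1 + a2 x2 + a3 x3\<close>, and one may take it primitive.
  Differentiating the relation along \<open>a\<close> yields syzygies
  \<open>\<sigma>(j, k) = xk \<partial>g/\<partial>aj - xj \<partial>g/\<partial>ak\<close> of degree \<open>e + 1\<close>.  Since \<open>F\<close> is orthogonal to
  \<open>g\<close> and \<open>\<sigma>(j, k)\<close>, the dual of the two-form \<open>g \<and> \<sigma>(j, k)\<close> is killed by \<open>F \<and>\<close>, and
  by exactness of the Koszul complex on the plane it equals \<open>F \<and> v(j, k)\<close> with \<open>v(j, k)\<close> of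
  degree \<open>2 e + 1 - d \<le> 0\<close>.  The relation between the three \<open>\<sigma>(j, k)\<close> then forces
  \<open>v(j, k) = 0\<close>, so \<open>\<sigma>(j, k)\<close> is a multiple of \<open>g\<close>, and it vanishes because its degree
  in \<open>a\<close> is smaller.  Hence \<open>g\<close> is the restriction of a vector independent of \<open>a\<close>, that is,
  of a syzygy of \<open>F1, ..., F4\<close> on the whole space; this is a Koszul syzygy, impossible in
  degree \<open>e < d\<close>.
\<close>

subsection \<open>Evaluation homomorphisms of polynomial rings\<close>

text \<open>Four forms of positive degree in the three variables of a plane are never a regular
  sequence, so exactness on the plane is inherited from the whole space. There, wedging with F is
  exact on one-, two- and three-forms; passing to the quotient by a nonzero equation costs one
  position and leaves one- and two-forms, the two places where it is used.

  The vanishing of all \<open>sigma j k\<close> says that the gradient of g in a is parallel to (x1,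
  x2, x3), so g depends on a only through a1 x1 + a2 x2 + a3 x3. On the plane this combination is
  x0, which is why g lifts to the whole space; the lift is a Taylor expansion and uses
  characteristic zero.

  Syzygies of degree e on the plane solve a linear system with coefficients polynomial in a.
  Elimination without fractions yields either a solution polynomial in a or a nonzero polynomial
  q(a) whose nonvanishing excludes nonzero solutions; this is what "general" amounts to. Only the
  largest e is treated: syzygies of smaller degree are multiplied by a power of x1, so one open set
  serves all t.\<close>

lemma ring_homD:
  assumes "comm_ring_hom h"
  shows "h (a + b) = h a + h b" "h (a * b) = h a * h b" "h 0 = 0" "h 1 = 1"
    "h (a - b) = h a - h b" "h (- a) = - h a" "h (a ^ n) = h a ^ n"
    "h (sum f A) = (\<Sum>x\<in>A. h (f x))" "h (prod f A) = (\<Prod>x\<in>A. h (f x))"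
proof -
  interpret comm_ring_hom h by fact
  show "h (a + b) = h a + h b" "h (a * b) = h a * h b" "h 0 = 0" "h 1 = 1"
    "h (a - b) = h a - h b" "h (- a) = - h a" "h (a ^ n) = h a ^ n"
    "h (sum f A) = (\<Sum>x\<in>A. h (f x))" "h (prod f A) = (\<Prod>x\<in>A. h (f x))"
    by (simp_all add: hom_add hom_mult hom_minus hom_uminus hom_power hom_sum hom_prod)
qed

lemma ring_homI:
  fixes h :: "'a::comm_ring_1 \<Rightarrow> 'b::comm_ring_1"
  assumes "\<And>a b. h (a + b) = h a + h b" "\<And>a b. h (a * b) = h a * h b" "h 1 = 1"
  shows "comm_ring_hom h"
proof -
  have "h 0 + h 0 = h 0" using assms(1)[of undefined 0] by simp
  then have "h 0 = 0" by simp
  then show ?thesis by unfold_locales (use assms in auto)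
qed

lemma ring_hom_comp:
  assumes "comm_ring_hom g" "comm_ring_hom h"
  shows "comm_ring_hom (\<lambda>x. g (h x))"
  by (rule ring_homI) (simp_all add: ring_homD[OF assms(1)] ring_homD[OF assms(2)])

lemma ring_hom_id: "comm_ring_hom (\<lambda>x. x)"
  by (rule ring_homI) simp_all

definition pvar :: "'n \<Rightarrow> ('n, 'c::comm_ring_1) mpoly"
  where "pvar i = Poly_Mapping.single (Poly_Mapping.single i 1) 1"

definition pconst :: "'c \<Rightarrow> ('n, 'c::comm_ring_1) mpoly"
  where "pconst c = Poly_Mapping.single 0 c"

definition peval :: "('c \<Rightarrow> 'r) \<Rightarrow> ('n \<Rightarrow> 'r) \<Rightarrow> ('n::finite, 'c::comm_ring_1) mpoly \<Rightarrow> 'r::comm_ring_1"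
  where "peval h v p = (\<Sum>m\<in>Poly_Mapping.keys p. h (Poly_Mapping.lookup p m) * (\<Prod>i\<in>UNIV. v i ^ Poly_Mapping.lookup m i))"

lemma pconst_hom: "comm_ring_hom pconst"
  by (rule ring_homI) (simp_all add: pconst_def single_add mult_single)

lemma poly_mapping_sum_single:
  fixes p :: "'a \<Rightarrow>\<^sub>0 'b::comm_monoid_add"
  shows "p = (\<Sum>m\<in>Poly_Mapping.keys p. Poly_Mapping.single m (Poly_Mapping.lookup p m))"
  by (rule poly_mapping_eqI)
    (simp add: lookup_sum lookup_single when_def in_keys_iff sum.delta)

lemma poly_mapping_add_induct [case_names single add]:
  fixes p :: "'a \<Rightarrow>\<^sub>0 'b::comm_monoid_add"
  assumes "\<And>m c. P (Poly_Mapping.single m c)" "\<And>p q. P p \<Longrightarrow> P q \<Longrightarrow> P (p + q)"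
  shows "P p"
proof -
  have "P (\<Sum>m\<in>A. Poly_Mapping.single m (Poly_Mapping.lookup p m))" if "finite A" for A
    using that
  proof induction
    case empty
    show ?case using assms(1)[of undefined 0] by simp
  qed (simp add: assms)
  then show ?thesis using poly_mapping_sum_single[of p] finite_keys[of p] by metis
qed

lemma pvar_power: "pvar i ^ k = Poly_Mapping.single (Poly_Mapping.single i k) 1"
  by (induction k) (simp_all add: pvar_def mult_single flip: single_add)

lemma prod_single_one:
  "(\<Prod>i\<in>A. Poly_Mapping.single (f i) (1::'c::comm_ring_1)) = Poly_Mapping.single (\<Sum>i\<in>A. f i) 1"
  by (induction A rule: infinite_finite_induct) (simp_all add: mult_single)

lemma single_eq_prod_pvar:
  "Poly_Mapping.single m c = pconst c * (\<Prod>i\<in>UNIV. pvar (i::'n::finite) ^ Poly_Mapping.lookup m i)"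
proof -
  have "m = (\<Sum>i\<in>UNIV. Poly_Mapping.single i (Poly_Mapping.lookup m i))"
    by (rule poly_mapping_eqI) (simp add: lookup_sum lookup_single when_def sum.delta)
  then show ?thesis by (simp add: pvar_power prod_single_one pconst_def mult_single)
qed

lemma mpoly_induct [case_names const var add mult]:
  fixes p :: "('n::finite, 'c::comm_ring_1) mpoly"
  assumes c: "\<And>c. P (pconst c)" and v: "\<And>i. P (pvar i)"
    and a: "\<And>p q. P p \<Longrightarrow> P q \<Longrightarrow> P (p + q)" and m: "\<And>p q. P p \<Longrightarrow> P q \<Longrightarrow> P (p * q)"
  shows "P p"
proof (induction p rule: poly_mapping_add_induct)
  case (single mm cc)
  have 1: "P 1" using c[of 1] by (simp add: pconst_def)
  have pw: "P (pvar i ^ k)" for i k by (induction k) (auto intro: 1 m v)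
  have "P (\<Prod>i\<in>A. pvar i ^ Poly_Mapping.lookup mm i)" if "finite A" for A
    using that by induction (auto intro: 1 m pw)
  then show ?case by (auto simp: single_eq_prod_pvar intro!: m c)
qed (rule a)

lemma mpoly_induct2 [case_names const par var add mult]:
  fixes p :: "('n::finite, ('m::finite, 'c::comm_ring_1) mpoly) mpoly"
  assumes c: "\<And>c. P (pconst (pconst c))" and "\<And>i. P (pconst (pvar i))" and v: "\<And>i. P (pvar i)"
    and a: "\<And>p q. P p \<Longrightarrow> P q \<Longrightarrow> P (p + q)" and m: "\<And>p q. P p \<Longrightarrow> P q \<Longrightarrow> P (p * q)"
  shows "P p"
proof (induction p rule: mpoly_induct)
  case (const c)
  show ?case
    by (induction c rule: mpoly_induct)
      (auto simp: ring_homD[OF pconst_hom] assms)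
qed (use assms in auto)

lemma peval_superset:
  assumes "h 0 = 0" "finite A" "Poly_Mapping.keys p \<subseteq> A"
  shows "peval h v p = (\<Sum>m\<in>A. h (Poly_Mapping.lookup p m) * (\<Prod>i\<in>UNIV. v i ^ Poly_Mapping.lookup m i))"
  unfolding peval_def
  by (rule sum.mono_neutral_left) (use assms in \<open>auto simp: in_keys_iff\<close>)

lemma peval_single:
  "h 0 = 0 \<Longrightarrow> peval h v (Poly_Mapping.single m c) = h c * (\<Prod>i\<in>UNIV. v i ^ Poly_Mapping.lookup m i)"
  by (subst peval_superset[of h "{m}"]) (simp_all)

lemma peval_add:
  assumes h: "comm_ring_hom h"
  shows "peval h v (p + q) = peval h v p + peval h v q"
proof -
  let ?A = "Poly_Mapping.keys p \<union> Poly_Mapping.keys q"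
  note [simp] = ring_homD[OF h]
  have "peval h v (p + q) = (\<Sum>m\<in>?A. h (Poly_Mapping.lookup (p + q) m) * (\<Prod>i\<in>UNIV. v i ^ Poly_Mapping.lookup m i))"
    by (rule peval_superset) (auto simp: keys_add)
  also have "\<dots> = (\<Sum>m\<in>?A. h (Poly_Mapping.lookup p m) * (\<Prod>i\<in>UNIV. v i ^ Poly_Mapping.lookup m i))
      + (\<Sum>m\<in>?A. h (Poly_Mapping.lookup q m) * (\<Prod>i\<in>UNIV. v i ^ Poly_Mapping.lookup m i))"
    by (simp add: lookup_add algebra_simps sum.distrib)
  also have "\<dots> = peval h v p + peval h v q"
    by (subst (1 2) peval_superset[where A = ?A]) auto
  finally show ?thesis .
qed

lemma peval_hom:
  assumes h: "comm_ring_hom h"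
  shows "comm_ring_hom (peval h v)"
proof (rule ring_homI)
  note [simp] = ring_homD[OF h]
  show "peval h v (p + q) = peval h v p + peval h v q" for p q by (rule peval_add[OF h])
  show "peval h v 1 = 1" using peval_single[of h v 0 1] by simp
  show "peval h v (p * q) = peval h v p * peval h v q" for p q
  proof (induction p rule: poly_mapping_add_induct)
    case (single m c)
    show ?case
    proof (induction q rule: poly_mapping_add_induct)
      case (single n d)
      show ?case
        by (simp add: mult_single peval_single lookup_add power_add prod.distrib mult_ac)
    qed (simp add: distrib_left peval_add[OF h])
  qed (simp add: distrib_right peval_add[OF h])
qed

lemma peval_pconst [simp]: "h 0 = 0 \<Longrightarrow> peval h v (pconst c) = h c"
  by (simp add: pconst_def peval_single)

lemma peval_pvar [simp]:
  assumes h: "comm_ring_hom h"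
  shows "peval h v (pvar i) = v i"
proof -
  have "(\<Prod>j\<in>UNIV. v j ^ Poly_Mapping.lookup (Poly_Mapping.single i 1) j) = (\<Prod>j\<in>UNIV. if j = i then v i else 1)"
    by (rule prod.cong) (auto simp: lookup_single)
  then show ?thesis by (simp add: pvar_def peval_single ring_homD[OF h])
qed

lemma hom_eqI:
  fixes f g :: "('n::finite, 'c::comm_ring_1) mpoly \<Rightarrow> 'r::comm_ring_1"
  assumes "comm_ring_hom f" "comm_ring_hom g"
    and "\<And>c. f (pconst c) = g (pconst c)" "\<And>i. f (pvar i) = g (pvar i)"
  shows "f p = g p"
  by (induction p rule: mpoly_induct)
    (simp_all add: assms(3,4) ring_homD[OF assms(1)] ring_homD[OF assms(2)])

lemma hom_eqI2:
  fixes f g :: "('n::finite, ('m::finite, 'c::comm_ring_1) mpoly) mpoly \<Rightarrow> 'r::comm_ring_1"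
  assumes "comm_ring_hom f" "comm_ring_hom g"
    and "\<And>c. f (pconst (pconst c)) = g (pconst (pconst c))"
    "\<And>i. f (pconst (pvar i)) = g (pconst (pvar i))" "\<And>i. f (pvar i) = g (pvar i)"
  shows "f p = g p"
  by (induction p rule: mpoly_induct2)
    (simp_all add: assms(3-) ring_homD[OF assms(1)] ring_homD[OF assms(2)])

text \<open>The Leibniz rule is relative to \<open>h\<close> so that composites of \<open>pd\<close>
  or \<open>pderiv\<close> with a grading homomorphism, whose values lie in another ring, are
  covered and can be compared on constants, parameters and variables.\<close>

definition derivation_along :: "('a::comm_ring_1 \<Rightarrow> 'b::comm_ring_1) \<Rightarrow> ('a \<Rightarrow> 'b) \<Rightarrow> bool"
  where "derivation_along h E \<longleftrightarrow>
    (\<forall>p q. E (p + q) = E p + E q) \<and> (\<forall>p q. E (p * q) = E p * h q + h p * E q)"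

lemma derivation_eqI2:
  fixes h E E' :: "('n::finite, ('m::finite, 'c::comm_ring_1) mpoly) mpoly \<Rightarrow> 'r::comm_ring_1"
  assumes "derivation_along h E" "derivation_along h E'"
    and "\<And>c. E (pconst (pconst c)) = E' (pconst (pconst c))"
    "\<And>i. E (pconst (pvar i)) = E' (pconst (pvar i))" "\<And>i. E (pvar i) = E' (pvar i)"
  shows "E p = E' p"
  using assms(1,2) unfolding derivation_along_def
  by (induction p rule: mpoly_induct2) (simp_all add: assms(3-))

subsection \<open>Unique factorization\<close>

lemma exhaust_4_zero: "(i::4) = 0 \<or> i = 1 \<or> i = 2 \<or> i = 3"
proof (induct i)
  case (of_int z)
  then have "0 \<le> z" "z < 4" by simp_all
  then have "z = 0 \<or> z = 1 \<or> z = 2 \<or> z = 3" by arith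
  then show ?case by auto
qed

lemma UNIV_4_zero: "(UNIV::4 set) = {0, 1, 2, 3}"
  using exhaust_4_zero by auto

text \<open>Primitivity without gcds: every vector proportional to \<open>g\<close> is a multiple of
  \<open>g\<close>. For nonzero \<open>g\<close> over a factorial domain this means that the entries
  have gcd 1, and the formulation passes directly through ring isomorphisms.\<close>

definition saturated :: "nat \<Rightarrow> (nat \<Rightarrow> 'a::comm_ring_1) \<Rightarrow> bool"
  where "saturated n g \<longleftrightarrow>
    (\<forall>s. (\<forall>i<n. \<forall>j<n. g i * s j = g j * s i) \<longrightarrow> (\<exists>l. \<forall>i<n. s i = l * g i))"

lemma saturatedD:
  assumes "saturated n g" "\<And>i j. i < n \<Longrightarrow> j < n \<Longrightarrow> g i * s j = g j * s i"
  shows "\<exists>l. \<forall>i<n. s i = l * g i"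
  using assms unfolding saturated_def by blast

lemma saturatedI:
  assumes "\<And>s. (\<And>i j. i < n \<Longrightarrow> j < n \<Longrightarrow> g i * s j = g j * s i) \<Longrightarrow> \<exists>l. \<forall>i<n. s i = l * g i"
  shows "saturated n g"
  using assms unfolding saturated_def by blast

definition has_saturation :: "nat \<Rightarrow> (nat \<Rightarrow> 'a::comm_ring_1) \<Rightarrow> bool"
  where "has_saturation n g \<longleftrightarrow> (\<exists>c g'. (\<forall>i<n. g i = c * g' i) \<and> saturated n g')"

lemma ufd_has_saturation:
  fixes g :: "nat \<Rightarrow> 'a::ufd"
  assumes "i < n" "g i \<noteq> 0"
  shows "has_saturation n g"
proof -
  define G where "G f = some_gcd.listgcd (map f [0..<n])" for f :: "nat \<Rightarrow> 'a"
  have Gdvd: "G f dvd f j" if "j < n" for f j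
    unfolding G_def by (rule some_gcd.listgcd) (use that in auto)
  have Ggreat: "d dvd G f" if "\<And>j. j < n \<Longrightarrow> d dvd f j" for f d
    unfolding G_def by (rule some_gcd.listgcd_greatest) (use that in auto)
  define c where "c = G g"
  have c0: "c \<noteq> 0" using Gdvd[OF assms(1), of g] assms(2) by (auto simp: c_def)
  have "\<exists>g'. \<forall>j<n. g j = c * g' j"
    using Gdvd[of _ g] unfolding c_def dvd_def by metis
  then obtain g' where g': "\<And>j. j < n \<Longrightarrow> g j = c * g' j" by auto
  have prim: "e dvd 1" if "\<And>j. j < n \<Longrightarrow> e dvd g' j" for e
  proof -
    have "c * e dvd c" unfolding c_def
      by (rule Ggreat) (use that g' in \<open>auto simp: c_def intro: mult_dvd_mono\<close>)
    then show ?thesis using c0 by simp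
  qed
  have "saturated n g'"
  proof (rule saturatedI)
    fix s assume s: "\<And>i j. i < n \<Longrightarrow> j < n \<Longrightarrow> g' i * s j = g' j * s i"
    have gi: "g' i \<noteq> 0" using g'[OF assms(1)] assms(2) by auto
    have "g' i dvd s i"
    proof (cases "s i = 0")
      case False
      \<comment> \<open>As \<open>g'\<close> is primitive, the gcd \<open>D\<close> of all
        \<open>s i * g' j\<close> is associated to \<open>s i\<close>; by proportionality each of
        these products is also \<open>g' i * s j\<close>, so \<open>g' i\<close> divides
        \<open>D\<close>.\<close>
      define D where "D = G (\<lambda>j. s i * g' j)"
      have "g' i dvd D" unfolding D_def
      proof (rule Ggreat)
        fix j assume "j < n"
        then have "s i * g' j = g' i * s j" using s[OF assms(1), of j] by (simp add: mult.commute)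
        then show "g' i dvd s i * g' j" by simp
      qed
      have "s i dvd D" unfolding D_def by (rule Ggreat) simp
      then obtain u where u: "D = s i * u" by (auto simp: dvd_def)
      have "u dvd g' j" if "j < n" for j
        using Gdvd[OF that, of "\<lambda>j. s i * g' j"] False unfolding D_def[symmetric] u by simp
      then have "u dvd 1" by (rule prim)
      then have "D dvd s i" unfolding u using False by simp
      with \<open>g' i dvd D\<close> show ?thesis by (rule dvd_trans)
    qed simp
    then obtain l where l: "s i = g' i * l" by (auto simp: dvd_def)
    have "s j = l * g' j" if "j < n" for j
    proof -
      have "g' i * s j = g' i * (l * g' j)"
        using s[OF assms(1) that] l by (simp add: mult_ac)
      then show ?thesis using gi by simp
    qed
    then show "\<exists>l. \<forall>i<n. s i = l * g' i" by blast
  qed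
  with g' show ?thesis unfolding has_saturation_def by blast
qed

lemma has_saturation_transfer:
  assumes f: "comm_ring_hom f" and h: "comm_ring_hom h"
    and hf: "\<And>x. h (f x) = x" and fh: "\<And>y. f (h y) = y"
    and "has_saturation n (\<lambda>i. f (g i))"
  shows "has_saturation n g"
proof -
  note [simp] = ring_homD[OF f] ring_homD[OF h] hf fh
  obtain c g' where g': "\<And>i. i < n \<Longrightarrow> f (g i) = c * g' i" and sat: "saturated n g'"
    using assms(5) unfolding has_saturation_def by auto
  have "g i = h c * h (g' i)" if "i < n" for i
    using arg_cong[OF g'[OF that], of h] by simp
  moreover have "saturated n (\<lambda>i. h (g' i))"
  proof (rule saturatedI)
    fix s assume s: "\<And>i j. i < n \<Longrightarrow> j < n \<Longrightarrow> h (g' i) * s j = h (g' j) * s i"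
    have "g' i * f (s j) = g' j * f (s i)" if "i < n" "j < n" for i j
      using arg_cong[OF s[OF that], of f] by simp
    then obtain l where l: "\<forall>i<n. f (s i) = l * g' i"
      using saturatedD[OF sat, of "\<lambda>i. f (s i)"] by blast
    have "s i = h l * h (g' i)" if "i < n" for i
      using arg_cong[OF l[rule_format, OF that], of h] by simp
    then show "\<exists>l. \<forall>i<n. s i = l * h (g' i)" by blast
  qed
  ultimately show ?thesis
    unfolding has_saturation_def by (intro exI[of _ "h c"] exI[of _ "\<lambda>i. h (g' i)"]) simp
qed

section \<open>Iterated univariate polynomials and polynomials in four variables\<close>

lemma map_poly_hom:
  assumes "comm_ring_hom h"
  shows "comm_ring_hom (map_poly h)"
proof (rule ring_homI; rule poly_eqI)
  note h = ring_homD[OF assms]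
  fix n
  show "coeff (map_poly h (p + q)) n = coeff (map_poly h p + map_poly h q) n" for p q
    by (simp only: coeff_map_poly h coeff_add)
  show "coeff (map_poly h (p * q)) n = coeff (map_poly h p * map_poly h q) n" for p q
    by (simp only: coeff_map_poly h coeff_mult)
  show "coeff (map_poly h 1) n = coeff 1 n"
    by (cases n) (simp_all only: coeff_map_poly h one_pCons coeff_pCons_0 coeff_pCons_Suc coeff_0)
qed

lemma map_poly_const: "h 0 = 0 \<Longrightarrow> map_poly h [:a:] = [:h a:]"
  by (rule poly_eqI) (simp add: coeff_map_poly coeff_pCons split: nat.splits)

definition pX :: "'a::comm_ring_1 poly"
  where "pX = [:0, 1:]"

lemma poly_pX [simp]: "poly pX y = y"
  by (simp add: pX_def)

lemma map_poly_var:
  assumes "comm_ring_hom h"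
  shows "map_poly h pX = pX"
  by (rule poly_eqI)
    (simp add: pX_def coeff_map_poly coeff_pCons ring_homD[OF assms] split: nat.splits)

definition poly_eval_hom :: "('a \<Rightarrow> 'b) \<Rightarrow> 'b \<Rightarrow> 'a::comm_ring_1 poly \<Rightarrow> 'b::comm_ring_1"
  where "poly_eval_hom h y p = poly (map_poly h p) y"

lemma poly_eval_hom_hom:
  assumes "comm_ring_hom h"
  shows "comm_ring_hom (poly_eval_hom h y)"
  by (rule ring_homI) (simp_all add: poly_eval_hom_def ring_homD[OF map_poly_hom[OF assms]])

lemma poly_eval_hom_const [simp]: "h 0 = 0 \<Longrightarrow> poly_eval_hom h y [:a:] = h a"
  by (simp add: poly_eval_hom_def map_poly_const)

lemma poly_eval_hom_var [simp]:
  "comm_ring_hom h \<Longrightarrow> poly_eval_hom h y pX = y"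
  by (simp add: poly_eval_hom_def map_poly_var)

lemma poly_hom_eqI:
  fixes f g :: "'a::comm_ring_1 poly \<Rightarrow> 'b::comm_ring_1"
  assumes f: "comm_ring_hom f" and g: "comm_ring_hom g"
    and "\<And>a. f [:a:] = g [:a:]" "f pX = g pX"
  shows "f p = g p"
proof (induction p)
  case 0
  show ?case by (simp add: ring_homD[OF f] ring_homD[OF g])
next
  case (pCons a p)
  have "pCons a p = [:a:] + pX * p" by (simp add: pX_def)
  then show ?case by (simp only: ring_homD[OF f] ring_homD[OF g] assms(3,4) pCons)
qed

lemma const_poly_hom:
  assumes "comm_ring_hom h"
  shows "comm_ring_hom (\<lambda>x. [:h x:])"
  by (rule ring_homI) (simp_all add: ring_homD[OF assms] mult.commute pCons_one)

definition nested_var :: "4 \<Rightarrow> 'd::comm_ring_1 poly poly poly poly"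
  where "nested_var i = (if i = 0 then pX else if i = 1 then [:pX:]
    else if i = 2 then [:[:pX:]:] else [:[:[:pX:]:]:])"

definition to_nested :: "('c \<Rightarrow> 'd) \<Rightarrow> (4, 'c::comm_ring_1) mpoly \<Rightarrow> 'd::comm_ring_1 poly poly poly poly"
  where "to_nested h = peval (\<lambda>c. [:[:[:[:h c:]:]:]:]) nested_var"

definition nested_eval :: "('d \<Rightarrow> 'r) \<Rightarrow> (4 \<Rightarrow> 'r) \<Rightarrow> 'd::comm_ring_1 poly poly poly poly \<Rightarrow> 'r::comm_ring_1"
  where "nested_eval h y = poly_eval_hom (poly_eval_hom (poly_eval_hom (poly_eval_hom h (y 3)) (y 2)) (y 1)) (y 0)"

lemma to_nested_hom: "comm_ring_hom h \<Longrightarrow> comm_ring_hom (to_nested h)"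
  unfolding to_nested_def by (intro peval_hom const_poly_hom)

lemma nested_eval_hom:
  assumes "comm_ring_hom h"
  shows "comm_ring_hom (nested_eval h y)"
  unfolding nested_eval_def
  by (rule poly_eval_hom_hom[OF poly_eval_hom_hom[OF poly_eval_hom_hom[OF poly_eval_hom_hom[OF assms]]]])

lemma to_nested_simps [simp]:
  assumes "comm_ring_hom h"
  shows "to_nested h (pconst c) = [:[:[:[:h c:]:]:]:]" "to_nested h (pvar i) = nested_var i"
  unfolding to_nested_def
  by (simp_all add: ring_homD[OF assms] peval_pvar const_poly_hom assms)

lemma nested_eval_const [simp]:
  assumes h: "comm_ring_hom h"
  shows "nested_eval h y [:[:[:[:c:]:]:]:] = h c"
  unfolding nested_eval_def
  by (simp add: ring_homD(3)[OF h] ring_homD(3)[OF poly_eval_hom_hom] poly_eval_hom_hom h)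

lemma nested_eval_var [simp]:
  assumes h: "comm_ring_hom h"
  shows "nested_eval h y (nested_var i) = y i"
  using exhaust_4_zero[of i]
  by (elim disjE)
    (simp_all add: nested_eval_def nested_var_def
      ring_homD(3)[OF h] ring_homD(3)[OF poly_eval_hom_hom] poly_eval_hom_hom h)

lemma nested_hom_eqI:
  fixes f g :: "'a::comm_ring_1 poly poly poly poly \<Rightarrow> 'b::comm_ring_1"
  assumes f: "comm_ring_hom f" and g: "comm_ring_hom g"
    and "\<And>a. f [:[:[:[:a:]:]:]:] = g [:[:[:[:a:]:]:]:]" "\<And>i. f (nested_var i) = g (nested_var i)"
  shows "f p = g p"
proof -
  note c = const_poly_hom[OF ring_hom_id] const_poly_hom[OF const_poly_hom[OF ring_hom_id]]
    const_poly_hom[OF const_poly_hom[OF const_poly_hom[OF ring_hom_id]]]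
  have v: "f pX = g pX" "f [:pX:] = g [:pX:]"
    "f [:[:pX:]:] = g [:[:pX:]:]" "f [:[:[:pX:]:]:] = g [:[:[:pX:]:]:]"
    using assms(4)[of 0] assms(4)[of 1] assms(4)[of 2] assms(4)[of 3]
    by (simp_all add: nested_var_def)
  have 1: "f [:[:[:p:]:]:] = g [:[:[:p:]:]:]" for p
    using poly_hom_eqI[OF ring_hom_comp[OF f c(3)] ring_hom_comp[OF g c(3)]] assms(3) v by simp
  have 2: "f [:[:p:]:] = g [:[:p:]:]" for p
    using poly_hom_eqI[OF ring_hom_comp[OF f c(2)] ring_hom_comp[OF g c(2)]] 1 v by simp
  have 3: "f [:p:] = g [:p:]" for p
    using poly_hom_eqI[OF ring_hom_comp[OF f c(1)] ring_hom_comp[OF g c(1)]] 2 v by simp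
  show ?thesis by (rule poly_hom_eqI[OF f g 3 v(1)])
qed

lemma nested_iso:
  assumes h: "comm_ring_hom h" and k: "comm_ring_hom k"
    and kh: "\<And>x. k (h x) = x" and hk: "\<And>y. h (k y) = y"
  shows "nested_eval (\<lambda>c. pconst (k c)) pvar (to_nested h p) = p"
    "to_nested h (nested_eval (\<lambda>c. pconst (k c)) pvar q) = q"
proof -
  note k' = ring_hom_comp[OF pconst_hom k]
  note e = nested_eval_hom[OF k', of pvar] and t = to_nested_hom[OF h]
  show "nested_eval (\<lambda>c. pconst (k c)) pvar (to_nested h p) = p"
    by (rule hom_eqI[OF ring_hom_comp[OF e t] ring_hom_id]) (simp_all add: h k' kh)
  show "to_nested h (nested_eval (\<lambda>c. pconst (k c)) pvar q) = q"
    by (rule nested_hom_eqI[OF ring_hom_comp[OF t e] ring_hom_id]) (simp_all add: h k' hk)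
qed

text \<open>Unique factorization is carried over from univariate polynomials iterated eight times:
  four layers for the coefficient polynomials (\<open>h1\<close>) and four more above them
  (\<open>h2\<close>).\<close>

lemma mpoly_has_saturation:
  fixes g :: "nat \<Rightarrow> (4, (4, 'k::field) mpoly) mpoly"
  assumes "i < n" "g i \<noteq> 0"
  shows "has_saturation n g"
proof -
  define h1 where "h1 = to_nested (\<lambda>x::'k. x)"
  define k1 where "k1 = nested_eval (\<lambda>c::'k. pconst c) pvar"
  have h1: "comm_ring_hom h1" unfolding h1_def by (intro to_nested_hom ring_hom_id)
  have k1: "comm_ring_hom k1" unfolding k1_def by (intro nested_eval_hom pconst_hom)
  have kh1: "k1 (h1 x) = x" and hk1: "h1 (k1 y) = y" for x y
    unfolding h1_def k1_def using nested_iso[OF ring_hom_id ring_hom_id] by simp_all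
  define h2 where "h2 = to_nested h1"
  define k2 where "k2 = nested_eval (\<lambda>c. pconst (k1 c)) pvar"
  have h2: "comm_ring_hom h2" unfolding h2_def by (intro to_nested_hom h1)
  have k2: "comm_ring_hom k2" unfolding k2_def by (intro nested_eval_hom ring_hom_comp[OF pconst_hom] k1)
  have kh2: "k2 (h2 x) = x" and hk2: "h2 (k2 y) = y" for x y
    unfolding h2_def k2_def using nested_iso[OF h1 k1 kh1 hk1] by simp_all
  have "h2 (g i) \<noteq> 0"
    using assms(2) kh2[of "g i"] ring_homD(3)[OF k2] by auto
  then have "has_saturation n (\<lambda>i. h2 (g i))"
    using ufd_has_saturation[of i n "\<lambda>i. h2 (g i)"] assms(1) by simp
  then show ?thesis by (rule has_saturation_transfer[OF h2 k2 kh2 hk2])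
qed

section \<open>Points where a nonzero polynomial does not vanish\<close>

lemma poly_exists_nonroot:
  fixes p :: "'a::idom poly"
  assumes "p \<noteq> 0" "infinite (UNIV::'k set)" "inj (f::'k \<Rightarrow> 'a)"
  shows "\<exists>b. poly p (f b) \<noteq> 0"
proof (rule ccontr)
  assume "\<not> ?thesis"
  then have "range f \<subseteq> {x. poly p x = 0}" by auto
  then have "finite (range f)" using poly_roots_finite[OF assms(1)] finite_subset by blast
  then show False using assms(2,3) finite_imageD by blast
qed

text \<open>The coordinates are fixed one at a time, outermost variable first: a nonzero polynomial
  over a domain has finitely many roots, while the infinite field supplies infinitely many
  constants.\<close>

lemma mpoly_exists_nonroot:
  fixes p :: "(4, 'k::field_char_0) mpoly"
  assumes "p \<noteq> 0"
  shows "\<exists>a. peval (\<lambda>c. c) a p \<noteq> 0"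
proof -
  define P where "P = to_nested (\<lambda>c::'k. c) p"
  have inf: "infinite (UNIV::'k set)" by (rule infinite_UNIV_char_0)
  note c = const_poly_hom[OF ring_hom_id]
  have "P \<noteq> 0"
  proof
    assume "P = 0"
    then have "nested_eval pconst pvar P = (0 :: (4, 'k) mpoly)"
      by (simp only: ring_homD(3)[OF nested_eval_hom[OF pconst_hom]])
    then show False
      using nested_iso(1)[OF ring_hom_id ring_hom_id refl refl, of p] assms unfolding P_def by simp
  qed
  then obtain a0 where "poly P [:[:[:a0:]:]:] \<noteq> 0"
    using poly_exists_nonroot[OF _ inf, of P "\<lambda>a. [:[:[:a:]:]:]"] by (auto simp: inj_def)
  then obtain a1 where "poly (poly P [:[:[:a0:]:]:]) [:[:a1:]:] \<noteq> 0"
    using poly_exists_nonroot[OF _ inf, of _ "\<lambda>a. [:[:a:]:]"] by (auto simp: inj_def)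
  then obtain a2 where "poly (poly (poly P [:[:[:a0:]:]:]) [:[:a1:]:]) [:a2:] \<noteq> 0"
    using poly_exists_nonroot[OF _ inf, of _ "\<lambda>a. [:a:]"] by (auto simp: inj_def)
  then obtain a3 where nz: "poly (poly (poly (poly P [:[:[:a0:]:]:]) [:[:a1:]:]) [:a2:]) a3 \<noteq> 0"
    using poly_exists_nonroot[OF _ inf, of _ "\<lambda>a. a"] by (auto simp: inj_def)
  define a where "a = (\<lambda>i::4. if i = 0 then a0 else if i = 1 then a1 else if i = 2 then a2 else a3)"
  define E where "E q = poly (poly (poly (poly q [:[:[:a0:]:]:]) [:[:a1:]:]) [:a2:]) a3" for q
  have E: "comm_ring_hom E" unfolding E_def by (rule ring_homI) simp_all
  have "E (to_nested (\<lambda>c::'k. c) p) = peval (\<lambda>c. c) a p"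
  proof (rule hom_eqI[OF ring_hom_comp[OF E to_nested_hom[OF ring_hom_id]] peval_hom[OF ring_hom_id]])
    fix i :: 4
    show "E (to_nested (\<lambda>c::'k. c) (pvar i)) = peval (\<lambda>c. c) a (pvar i)"
      using exhaust_4_zero[of i]
      by (elim disjE) (simp_all add: ring_hom_id nested_var_def E_def a_def)
  qed (simp_all add: ring_hom_id E_def)
  then show ?thesis using nz unfolding E_def P_def by metis
qed

subsection \<open>Koszul complexes\<close>

text \<open>The nonzerodivisor conditions are written as ideal membership with explicit cofactors,
  so that they can be moved along ring isomorphisms and extended to polynomial rings
  coefficientwise.\<close>

definition regular_four :: "(nat \<Rightarrow> 'a::comm_ring_1) \<Rightarrow> bool"
  where "regular_four F \<longleftrightarrow> (\<forall>i<4. \<forall>p c. F i * p = (\<Sum>j<i. c j * F j) \<longrightarrow>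
    (\<exists>c'. p = (\<Sum>j<i. c' j * F j)))"

lemma regular_fourD:
  assumes "regular_four F"
  shows "F 0 * p = 0 \<Longrightarrow> p = 0"
    "F 1 * p = a * F 0 \<Longrightarrow> \<exists>a'. p = a' * F 0"
    "F 2 * p = a * F 0 + b * F 1 \<Longrightarrow> \<exists>a' b'. p = a' * F 0 + b' * F 1"
    "F 3 * p = a * F 0 + b * F 1 + c * F 2 \<Longrightarrow> \<exists>a' b' c'. p = a' * F 0 + b' * F 1 + c' * F 2"
proof -
  note r = assms[unfolded regular_four_def, rule_format]
  show "F 0 * p = 0 \<Longrightarrow> p = 0" using r[of 0 p] by simp
  show "F 1 * p = a * F 0 \<Longrightarrow> \<exists>a'. p = a' * F 0"
    using r[of 1 p "\<lambda>_. a"] by auto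
  show "F 2 * p = a * F 0 + b * F 1 \<Longrightarrow> \<exists>a' b'. p = a' * F 0 + b' * F 1"
    using r[of 2 p "\<lambda>j. if j = 0 then a else b"] by (auto simp: numeral_2_eq_2)
  show "F 3 * p = a * F 0 + b * F 1 + c * F 2 \<Longrightarrow> \<exists>a' b' c'. p = a' * F 0 + b' * F 1 + c' * F 2"
    using r[of 3 p "\<lambda>j. if j = 0 then a else if j = 1 then b else c"]
    by (auto simp: numeral_2_eq_2 numeral_3_eq_3)
qed

text \<open>Base of a recursion, continued for three and four forms, showing that syzygies of a
  regular sequence are Koszul: by regularity the last coordinate lies in the ideal of the earlier
  forms, and subtracting the matching Koszul syzygies leaves one form fewer.\<close>

lemma koszul_two:
  fixes F :: "nat \<Rightarrow> 'a::idom"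
  assumes F: "regular_four F" and e: "F 0 * A + F 1 * B = 0"
  shows "\<exists>p. A = p * F 1 \<and> B = - p * F 0"
proof -
  have "F 1 * B = (- A) * F 0" using e by (simp add: add_eq_0_iff mult.commute)
  then obtain b where b: "B = b * F 0" using regular_fourD(2)[OF F] by blast
  have "F 0 * (A + b * F 1) = 0" using e unfolding b by (simp add: algebra_simps)
  then have "A + b * F 1 = 0" by (rule regular_fourD(1)[OF F])
  then show ?thesis using b by (intro exI[of _ "- b"]) (simp add: eq_neg_iff_add_eq_0)
qed

lemma koszul_three:
  fixes F :: "nat \<Rightarrow> 'a::idom"
  assumes F: "regular_four F" and e: "F 0 * A + F 1 * B + F 2 * C = 0"
  shows "\<exists>p q r. A = p * F 1 + q * F 2 \<and> B = - p * F 0 + r * F 2 \<and> C = - q * F 0 - r * F 1"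
proof -
  have "F 2 * C = - (F 0 * A + F 1 * B)" using e by (rule iffD1[OF add_eq_0_iff])
  then have "F 2 * C = (- A) * F 0 + (- B) * F 1" by (simp add: algebra_simps)
  then obtain q r where C: "C = q * F 0 + r * F 1" using regular_fourD(3)[OF F] by blast
  have "F 0 * (A + q * F 2) + F 1 * (B + r * F 2) = 0" using e unfolding C by (simp add: algebra_simps)
  then obtain p where "A + q * F 2 = p * F 1" "B + r * F 2 = - p * F 0" using koszul_two[OF F] by blast
  then have "A = p * F 1 + (- q) * F 2 \<and> B = - p * F 0 + (- r) * F 2 \<and> C = - (- q) * F 0 - (- r) * F 1"
    using C by (simp add: eq_diff_eq[symmetric])
  then show ?thesis by blast
qed

lemma koszul_four:
  fixes F :: "nat \<Rightarrow> 'a::idom"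
  assumes F: "regular_four F" and e: "F 0 * A + F 1 * B + F 2 * C + F 3 * D = 0"
  shows "\<exists>p q r s t u. A = p * F 1 + q * F 2 + s * F 3 \<and> B = - p * F 0 + r * F 2 + t * F 3 \<and>
    C = - q * F 0 - r * F 1 + u * F 3 \<and> D = - s * F 0 - t * F 1 - u * F 2"
proof -
  have "F 3 * D = - (F 0 * A + F 1 * B + F 2 * C)" using e by (rule iffD1[OF add_eq_0_iff])
  then have "F 3 * D = (- A) * F 0 + (- B) * F 1 + (- C) * F 2" by (simp add: algebra_simps)
  then obtain s t u where D: "D = s * F 0 + t * F 1 + u * F 2" using regular_fourD(4)[OF F] by blast
  have "F 0 * (A + s * F 3) + F 1 * (B + t * F 3) + F 2 * (C + u * F 3) = 0"
    using e unfolding D by (simp add: algebra_simps)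
  then obtain p q r where "A + s * F 3 = p * F 1 + q * F 2" "B + t * F 3 = - p * F 0 + r * F 2"
    "C + u * F 3 = - q * F 0 - r * F 1" using koszul_three[OF F] by blast
  then have "A = p * F 1 + q * F 2 + (- s) * F 3 \<and> B = - p * F 0 + r * F 2 + (- t) * F 3 \<and>
    C = - q * F 0 - r * F 1 + (- u) * F 3 \<and> D = - (- s) * F 0 - (- t) * F 1 - (- u) * F 2"
    using D by (simp add: eq_diff_eq[symmetric])
  then show ?thesis by blast
qed

lemma all_less_4: "(\<forall>i<4::nat. P i) \<longleftrightarrow> P 0 \<and> P 1 \<and> P 2 \<and> P 3"
  by (auto simp: numeral_eq_Suc All_less_Suc)

text \<open>Exactness on one-forms: coordinate 0 yields \<open>s\<close>, and the others follow
  because \<open>F 0\<close> is a nonzerodivisor.\<close>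

lemma koszul_one_forms:
  fixes F :: "nat \<Rightarrow> 'a::idom"
  assumes F: "regular_four F" and e: "\<And>j. j < 4 \<Longrightarrow> F 0 * V j = F j * V 0"
  shows "\<exists>s. \<forall>i<4. V i = s * F i"
proof -
  have "F 1 * V 0 = V 1 * F 0" using e[of 1] by (simp add: mult.commute)
  then obtain s where s: "V 0 = s * F 0" using regular_fourD(2)[OF F] by blast
  have "V j = s * F j" if "j < 4" for j
  proof -
    have "F 0 * (V j - s * F j) = 0" using e[OF that] unfolding s by (simp add: algebra_simps)
    from regular_fourD(1)[OF F this] show ?thesis by simp
  qed
  then show ?thesis by blast
qed

text \<open>Exactness on two-forms, where the entries \<open>W i j\<close> with \<open>i < j\<close>
  are the coordinates of \<open>W\<close>.\<close>

lemma koszul_two_forms: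
  fixes F :: "nat \<Rightarrow> 'a::idom"
  assumes F: "regular_four F"
    and e: "\<And>i j k. i < j \<Longrightarrow> j < k \<Longrightarrow> k < 4 \<Longrightarrow> F i * W j k - F j * W i k + F k * W i j = 0"
  shows "\<exists>V. \<forall>i<4. \<forall>j<4. i < j \<longrightarrow> W i j = F i * V j - F j * V i"
proof -
  have "F 0 * W 1 2 + F 1 * (- W 0 2) + F 2 * W 0 1 = 0" using e[of 0 1 2] by simp
  then obtain p q r where pqr: "W 1 2 = p * F 1 + q * F 2" "- W 0 2 = - p * F 0 + r * F 2"
    "W 0 1 = - q * F 0 - r * F 1" using koszul_three[OF F] by blast
  have W02: "W 0 2 = p * F 0 - r * F 2" using arg_cong[OF pqr(2), of uminus] by simp
  \<comment> \<open>The three entries of \<open>W\<close> with indices below 3 already determine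
    \<open>V\<close> there as \<open>(r, - q, p)\<close>. Then \<open>A i\<close> is
    \<open>W i 3 + F 3 * V i\<close>, which has to be \<open>F i * u\<close> for one common
    \<open>u\<close>.\<close>
  define A where "A i = (if i = 0 then W 0 3 + r * F 3 else if i = 1 then W 1 3 - q * F 3 else W 2 3 + p * F 3)"
    for i :: nat
  have 1: "F 1 * A 0 = F 0 * A 1" 
  proof -
    have "F 0 * W 1 3 - F 1 * W 0 3 + F 3 * (- q * F 0 - r * F 1) = 0"
      using e[of 0 1 3] unfolding pqr(3) by simp
    then show ?thesis by (simp add: A_def algebra_simps)
  qed
  have 2: "F 2 * A 0 = F 0 * A 2" 
  proof -
    have "F 0 * W 2 3 - F 2 * W 0 3 + F 3 * (p * F 0 - r * F 2) = 0"
      using e[of 0 2 3] unfolding W02 by simp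
    then show ?thesis by (simp add: A_def algebra_simps)
  qed
  obtain u where u0: "A 0 = u * F 0" using regular_fourD(2)[OF F, of "A 0" "A 1"] 1 by (auto simp: mult.commute)
  have nz: "p = q" if "F 0 * p = F 0 * q" for p q
  proof -
    have "F 0 * (p - q) = 0" using that by (simp add: algebra_simps)
    from regular_fourD(1)[OF F this] show ?thesis by simp
  qed
  have u1: "A 1 = u * F 1" by (rule nz) (use 1 u0 in \<open>auto simp: mult_ac\<close>)
  have u2: "A 2 = u * F 2" by (rule nz) (use 2 u0 in \<open>auto simp: mult_ac\<close>)
  have W: "W 0 3 = - r * F 3 + u * F 0" "W 1 3 = q * F 3 + u * F 1" "W 2 3 = - p * F 3 + u * F 2"
    using u0 u1 u2 by (simp_all add: A_def algebra_simps)
  show ?thesis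
    by (rule exI[of _ "\<lambda>i. if i = 0 then r else if i = 1 then - q else if i = 2 then p else u"])
      (use pqr W02 W in \<open>simp add: all_less_4 algebra_simps\<close>)
qed

text \<open>Exactness modulo \<open>L\<close> at one-forms comes from exactness at two-forms: the
  quotients \<open>T\<close> of F wedge V by \<open>L\<close> satisfy the cocycle condition, hence
  are F wedge \<open>U\<close>, and \<open>V - L * U\<close> is an honest cocycle.\<close>

lemma koszul_one_forms_mod:
  fixes F :: "nat \<Rightarrow> 'a::idom"
  assumes F: "regular_four F" and L: "L \<noteq> 0"
    and e: "\<And>i j. i < j \<Longrightarrow> j < 4 \<Longrightarrow> L dvd F i * V j - F j * V i"
  shows "\<exists>s. \<forall>i<4. L dvd V i - s * F i"
proof -
  obtain T where T: "\<And>i j. i < j \<Longrightarrow> j < 4 \<Longrightarrow> F i * V j - F j * V i = L * T i j"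
    using e unfolding dvd_def by metis
  have "F i * T j k - F j * T i k + F k * T i j = 0" if "i < j" "j < k" "k < 4" for i j k
  proof -
    have "L * (F i * T j k - F j * T i k + F k * T i j)
      = F i * (L * T j k) - F j * (L * T i k) + F k * (L * T i j)" by (simp add: algebra_simps)
    also have "\<dots> = F i * (F j * V k - F k * V j) - F j * (F i * V k - F k * V i) + F k * (F i * V j - F j * V i)"
      using that by (simp add: T)
    also have "\<dots> = 0" by (simp add: algebra_simps)
    finally show ?thesis using L by simp
  qed
  then obtain U where U: "\<forall>i<4. \<forall>j<4. i < j \<longrightarrow> T i j = F i * U j - F j * U i"
    using koszul_two_forms[OF F, of T] by blast
  have "F 0 * (V j - L * U j) = F j * (V 0 - L * U 0)" if "j < 4" for j
  proof (cases "j = 0")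
    case False
    then have "F 0 * V j - F j * V 0 = L * (F 0 * U j - F j * U 0)"
      using T[of 0 j] U[rule_format, of 0 j] that by simp
    then show ?thesis by (simp add: algebra_simps)
  qed simp
  then obtain s where "\<forall>i<4. V i - L * U i = s * F i"
    using koszul_one_forms[OF F, of "\<lambda>i. V i - L * U i"] by blast
  then have "\<forall>i<4. V i - s * F i = L * U i" by (simp add: algebra_simps)
  then show ?thesis by (metis dvd_triv_left)
qed

text \<open>In four coordinates, wedging a three-form with F gives a single signed sum, so exactness
  here is \<open>koszul_four\<close> with the coordinates renamed and signed.\<close>

lemma koszul_three_forms:
  fixes F :: "nat \<Rightarrow> 'a::idom"
  assumes F: "regular_four F" and e: "F 0 * T 1 2 3 - F 1 * T 0 2 3 + F 2 * T 0 1 3 - F 3 * T 0 1 2 = 0"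
  shows "\<exists>W. \<forall>i j k. i < j \<longrightarrow> j < k \<longrightarrow> k < (4::nat) \<longrightarrow>
    T i j k = F i * W j k - F j * W i k + F k * W i (j::nat)"
proof -
  have "F 0 * T 1 2 3 + F 1 * (- T 0 2 3) + F 2 * T 0 1 3 + F 3 * (- T 0 1 2) = 0"
    using e by simp
  then obtain p q r s t u where *: "T 1 2 3 = p * F 1 + q * F 2 + s * F 3"
    "- T 0 2 3 = - p * F 0 + r * F 2 + t * F 3" "T 0 1 3 = - q * F 0 - r * F 1 + u * F 3"
    "- T 0 1 2 = - s * F 0 - t * F 1 - u * F 2"
    using koszul_four[OF F] by blast
  have **: "T 0 2 3 = p * F 0 - r * F 2 - t * F 3" "T 0 1 2 = s * F 0 + t * F 1 + u * F 2"
    using arg_cong[OF *(2), of uminus] arg_cong[OF *(4), of uminus] by simp_all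
  define W where "W i j = (if i = 2 then p else if i = 1 \<and> j = 3 then - q else if i = 1 then s
    else if j = 3 then r else if j = 2 then - t else u)" for i j :: nat
  have "T i j k = F i * W j k - F j * W i k + F k * W i j" if "i < j" "j < k" "k < 4" for i j k
  proof -
    from that have "i = 1 \<and> j = 2 \<and> k = 3 \<or> i = 0 \<and> j = 2 \<and> k = 3 \<or> i = 0 \<and> j = 1 \<and> k = 3
      \<or> i = 0 \<and> j = 1 \<and> k = 2" by auto
    then show ?thesis
      by (elim disjE) (use *(1,3) ** in \<open>simp_all add: W_def algebra_simps\<close>)
  qed
  then show ?thesis by blast
qed

text \<open>The same correction by a multiple of \<open>L\<close> as for one-forms, now drawing on
  exactness at three-forms. This is the last position reached by four forms.\<close>

lemma koszul_two_forms_mod: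
  fixes F :: "nat \<Rightarrow> 'a::idom"
  assumes F: "regular_four F" and L: "L \<noteq> 0"
    and e: "\<And>i j k. i < j \<Longrightarrow> j < k \<Longrightarrow> k < 4 \<Longrightarrow> L dvd F i * W j k - F j * W i k + F k * W i j"
  shows "\<exists>V. \<forall>i<4. \<forall>j<4. i < j \<longrightarrow> L dvd W i j - (F i * V j - F j * V i)"
proof -
  obtain T where T: "\<And>i j k. i < j \<Longrightarrow> j < k \<Longrightarrow> k < 4 \<Longrightarrow> F i * W j k - F j * W i k + F k * W i j = L * T i j k"
    using e unfolding dvd_def by metis
  have "L * (F 0 * T 1 2 3 - F 1 * T 0 2 3 + F 2 * T 0 1 3 - F 3 * T 0 1 2)
    = F 0 * (L * T 1 2 3) - F 1 * (L * T 0 2 3) + F 2 * (L * T 0 1 3) - F 3 * (L * T 0 1 2)"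
    by (simp add: algebra_simps)
  also have "\<dots> = 0" by (simp add: T[symmetric]) (simp add: algebra_simps)
  finally have "F 0 * T 1 2 3 - F 1 * T 0 2 3 + F 2 * T 0 1 3 - F 3 * T 0 1 2 = 0" using L by simp
  then obtain U where U: "\<forall>i j k. i < j \<longrightarrow> j < k \<longrightarrow> k < 4 \<longrightarrow>
    T i j k = F i * U j k - F j * U i k + F k * U i j"
    using koszul_three_forms[OF F, of T] by blast
  have "F i * (W j k - L * U j k) - F j * (W i k - L * U i k) + F k * (W i j - L * U i j) = 0"
    if "i < j" "j < k" "k < 4" for i j k
    using T[OF that] U[rule_format, OF that] by (simp add: algebra_simps)
  then obtain V where "\<forall>i<4. \<forall>j<4. i < j \<longrightarrow> W i j - L * U i j = F i * V j - F j * V i"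
    using koszul_two_forms[OF F, of "\<lambda>i j. W i j - L * U i j"] by blast
  then have "\<forall>i<4. \<forall>j<4. i < j \<longrightarrow> W i j - (F i * V j - F j * V i) = L * U i j"
    by (simp add: algebra_simps)
  then show ?thesis by (metis dvd_triv_left)
qed

text \<open>Outer variables are the coordinates x, inner ones the plane parameters a. Both layers
  are indexed by \<open>4\<close>, so exchanging them is an endomorphism; the plane involves the
  parameters 1, 2, 3.\<close>

type_synonym 'k bipoly = "(4, (4, 'k) mpoly) mpoly"

abbreviation bconst :: "'k \<Rightarrow> 'k::comm_ring_1 bipoly" where "bconst c \<equiv> pconst (pconst c)"
abbreviation par :: "4 \<Rightarrow> 'k::comm_ring_1 bipoly" where "par i \<equiv> pconst (pvar i)"

lemma bconst_hom: "comm_ring_hom bconst"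
  by (rule ring_hom_comp[OF pconst_hom pconst_hom])

definition bieval :: "('k \<Rightarrow> 'r) \<Rightarrow> (4 \<Rightarrow> 'r) \<Rightarrow> (4 \<Rightarrow> 'r) \<Rightarrow> 'k::comm_ring_1 bipoly \<Rightarrow> 'r::comm_ring_1"
  where "bieval c a x = peval (peval c a) x"

lemma bieval_hom: "comm_ring_hom c \<Longrightarrow> comm_ring_hom (bieval c a x)"
  unfolding bieval_def by (intro peval_hom)

lemma bieval_simps [simp]:
  assumes "comm_ring_hom c"
  shows "bieval c a x (bconst z) = c z" "bieval c a x (par i) = a i" "bieval c a x (pvar i) = x i"
  by (simp_all add: bieval_def assms peval_hom[OF assms] ring_homD(3)[OF assms]
    ring_homD(3)[OF peval_hom[OF assms]])

definition bi_embed :: "(4, 'k) mpoly \<Rightarrow> 'k::comm_ring_1 bipoly"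
  where "bi_embed = peval bconst pvar"

lemma bi_embed_hom: "comm_ring_hom bi_embed"
  unfolding bi_embed_def by (rule peval_hom[OF bconst_hom])

lemma bi_embed_simps [simp]: "bi_embed (pconst c) = bconst c" "bi_embed (pvar i) = pvar i"
  unfolding bi_embed_def by (simp_all add: bconst_hom ring_homD[OF bconst_hom])

subsection \<open>Gradings\<close>

text \<open>Every generator is multiplied by the power of a new variable given by its weight, so the
  coefficient of the power \<open>s\<close> is the component of weight \<open>s\<close>. Different
  weights give the degrees in x, in a and in x0 alone, and multiplicativity is that of a ring
  homomorphism.\<close>

definition grade :: "(4 \<Rightarrow> nat) \<Rightarrow> (4 \<Rightarrow> nat) \<Rightarrow> 'k bipoly \<Rightarrow> 'k::comm_ring_1 bipoly poly"
  where "grade wa wx = bieval (\<lambda>z. [:bconst z:]) (\<lambda>i. monom (par i) (wa i)) (\<lambda>i. monom (pvar i) (wx i))"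

lemma grade_hom: "comm_ring_hom (grade wa wx)"
  unfolding grade_def by (rule bieval_hom[OF const_poly_hom[OF bconst_hom]])

lemma grade_simps [simp]:
  "grade wa wx (bconst z) = [:bconst z:]" "grade wa wx (par i) = monom (par i) (wa i)"
  "grade wa wx (pvar i) = monom (pvar i) (wx i)"
  unfolding grade_def by (simp_all add: const_poly_hom[OF bconst_hom])

lemma poly_eval_is_hom: "comm_ring_hom (\<lambda>p. poly p a)"
  by (rule ring_homI) simp_all

lemma poly_grade_1: "poly (grade wa wx p) 1 = p"
  by (rule hom_eqI2[OF ring_hom_comp[OF poly_eval_is_hom grade_hom] ring_hom_id]) (simp_all add: poly_monom)

lemma grade_eq_0_iff [simp]: "grade wa wx p = 0 \<longleftrightarrow> p = 0"
  using poly_grade_1[of wa wx p] by (auto simp: ring_homD[OF grade_hom])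

definition graded :: "(4 \<Rightarrow> nat) \<Rightarrow> (4 \<Rightarrow> nat) \<Rightarrow> nat \<Rightarrow> 'k::comm_ring_1 bipoly \<Rightarrow> bool"
  where "graded wa wx s p \<longleftrightarrow> grade wa wx p = monom p s"

lemma graded_monomD: "grade wa wx p = monom q s \<Longrightarrow> graded wa wx s p"
  using poly_grade_1[of wa wx p] by (simp add: graded_def poly_monom)

lemma graded_add: "graded wa wx s p \<Longrightarrow> graded wa wx s q \<Longrightarrow> graded wa wx s (p + q)"
  and graded_diff: "graded wa wx s p \<Longrightarrow> graded wa wx s q \<Longrightarrow> graded wa wx s (p - q)"
  and graded_mult: "graded wa wx s p \<Longrightarrow> graded wa wx t q \<Longrightarrow> graded wa wx (s + t) (p * q)"
  and graded_0: "graded wa wx s 0"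
  by (simp_all add: graded_def ring_homD[OF grade_hom] add_monom diff_monom mult_monom)

lemma graded_pvar: "graded wa wx (wx i) (pvar i)"
  by (simp add: graded_def)

lemma graded_par: "graded wa wx (wa i) (par i)"
  by (simp add: graded_def)

lemma monom_factor:
  fixes P Q :: "'a::idom poly"
  assumes "P * Q = monom c s" "c \<noteq> 0"
  shows "\<exists>a i b j. P = monom a i \<and> Q = monom b j \<and> i + j = s"
  using assms(1)
proof (induction s arbitrary: P Q)
  case 0
  then have "P * Q = [:c:]" by (simp add: monom_0)
  moreover from this have "P \<noteq> 0" "Q \<noteq> 0" using assms(2) by auto
  ultimately have "degree P + degree Q = 0" using degree_mult_eq[of P Q] by simp
  then obtain a b where "P = [:a:]" "Q = [:b:]" by (auto elim!: degree_eq_zeroE)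
  then have "P = monom a 0 \<and> Q = monom b 0 \<and> 0 + 0 = (0::nat)" by (simp add: monom_0)
  then show ?case by blast
next
  case (Suc s)
  have "coeff (P * Q) 0 = 0" unfolding Suc.prems by simp
  then have "coeff P 0 = 0 \<or> coeff Q 0 = 0" by (simp add: coeff_mult)
  then show ?case
  proof
    assume "coeff P 0 = 0"
    then obtain P' where P: "P = pCons 0 P'" by (cases P) auto
    have "P' * Q = monom c s" using Suc.prems unfolding P by (simp add: monom_Suc)
    then obtain a i b j where "P' = monom a i" "Q = monom b j" "i + j = s" using Suc.IH by blast
    then have "P = monom a (Suc i) \<and> Q = monom b j \<and> Suc i + j = Suc s" unfolding P by (simp add: monom_Suc)
    then show ?thesis by blast
  next
    assume "coeff Q 0 = 0"
    then obtain Q' where Q: "Q = pCons 0 Q'" by (cases Q) auto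
    have "P * Q' = monom c s" using Suc.prems unfolding Q by (simp add: monom_Suc)
    then obtain a i b j where "P = monom a i" "Q' = monom b j" "i + j = s" using Suc.IH by blast
    then have "P = monom a i \<and> Q = monom b (Suc j) \<and> i + Suc j = Suc s" unfolding Q by (simp add: monom_Suc)
    then show ?thesis by blast
  qed
qed

text \<open>Over a domain the factors of a monomial are monomials, and \<open>grade\<close> turns
  homogeneous elements into monomials. This makes both the content of a homogeneous vector and its
  primitive part homogeneous.\<close>

lemma graded_factor:
  fixes p q :: "'k::idom bipoly"
  assumes "graded wa wx s (p * q)" "p * q \<noteq> 0"
  shows "\<exists>i j. i + j = s \<and> graded wa wx i p \<and> graded wa wx j q"
proof -
  have "grade wa wx p * grade wa wx q = monom (p * q) s"
    using assms(1) by (simp add: graded_def ring_homD[OF grade_hom])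
  from monom_factor[OF this assms(2)] show ?thesis using graded_monomD by blast
qed

lemma graded_unique:
  "graded wa wx s p \<Longrightarrow> graded wa wx t p \<Longrightarrow> p \<noteq> 0 \<Longrightarrow> s = t"
  unfolding graded_def by (metis degree_monom_eq)

subsection \<open>Derivations\<close>

text \<open>Taylor expansion in one parameter: \<open>par j\<close> is shifted by a new variable
  whose linear coefficient is the partial derivative \<open>pd j\<close>. The Leibniz rule is then
  read off a product of expansions.\<close>

definition par_shift :: "4 \<Rightarrow> 'k bipoly \<Rightarrow> 'k::comm_ring_1 bipoly poly"
  where "par_shift j = bieval (\<lambda>z. [:bconst z:]) (\<lambda>i. if i = j then [:par i, 1:] else [:par i:]) (\<lambda>i. [:pvar i:])"

definition pd :: "4 \<Rightarrow> 'k bipoly \<Rightarrow> 'k::comm_ring_1 bipoly"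
  where "pd j p = coeff (par_shift j p) 1"

lemma par_shift_hom: "comm_ring_hom (par_shift j)"
  unfolding par_shift_def by (rule bieval_hom[OF const_poly_hom[OF bconst_hom]])

lemma par_shift_simps [simp]:
  "par_shift j (bconst z) = [:bconst z:]" "par_shift j (par i) = (if i = j then [:par i, 1:] else [:par i:])"
  "par_shift j (pvar i) = [:pvar i:]"
  unfolding par_shift_def by (simp_all add: const_poly_hom[OF bconst_hom])

lemma coeff_par_shift_0: "coeff (par_shift j p) 0 = p"
  unfolding poly_0_coeff_0[symmetric]
  by (rule hom_eqI2[OF ring_hom_comp[OF poly_eval_is_hom par_shift_hom] ring_hom_id]) simp_all

lemma pd_simps [simp]:
  "pd j (bconst z) = 0" "pd j (par i) = (if i = j then 1 else 0)" "pd j (pvar i) = 0"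
  by (simp_all add: pd_def)

lemma pd_add: "pd j (p + q) = pd j p + pd j q"
  and pd_diff: "pd j (p - q) = pd j p - pd j q"
  and pd_0 [simp]: "pd j 0 = 0"
  and pd_1 [simp]: "pd j 1 = 0"
  by (simp_all add: pd_def ring_homD[OF par_shift_hom])

lemma pd_mult: "pd j (p * q) = pd j p * q + p * pd j q"
  by (simp add: pd_def ring_homD[OF par_shift_hom] coeff_mult coeff_par_shift_0)

lemma pd_sum: "pd j (sum f A) = (\<Sum>i\<in>A. pd j (f i))"
  by (induction A rule: infinite_finite_induct) (simp_all add: pd_add)

lemma pd_power: "pd j (p ^ Suc n) = of_nat (Suc n) * p ^ n * pd j p"
  by (induction n) (simp_all add: pd_mult algebra_simps)

lemma pd_bi_embed [simp]: "pd j (bi_embed p) = 0"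
  by (induction p rule: mpoly_induct) (simp_all add: ring_homD[OF bi_embed_hom] pd_add pd_mult)

lemma pd_commute: "pd j (pd k p) = pd k (pd j p)"
proof -
  have "pd j (pd k p) - pd k (pd j p) = (\<lambda>_. 0) p"
    by (rule derivation_eqI2[where h = "\<lambda>x. x"])
      (simp_all add: derivation_along_def pd_add pd_mult algebra_simps)
  then show ?thesis by simp
qed

text \<open>Differentiation by \<open>par j\<close> lowers the weight by \<open>wa j\<close>; the
  monomial factor on the left restores it, which avoids subtraction of exponents.\<close>

lemma grade_pd:
  fixes p :: "'k::comm_ring_1 bipoly"
  shows "monom 1 (wa j) * grade wa wx (pd j p) = map_poly (pd j) (grade wa wx p)"
proof (rule derivation_eqI2[where h = "grade wa wx"])
  show "derivation_along (grade wa wx) (\<lambda>p. monom 1 (wa j) * grade wa wx (pd j p))"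
    by (simp add: derivation_along_def pd_add pd_mult ring_homD[OF grade_hom] algebra_simps)
  have "map_poly (pd j) (P + Q) = map_poly (pd j) P + map_poly (pd j) Q" for P Q :: "'k bipoly poly"
    by (rule poly_eqI) (simp add: coeff_map_poly pd_add)
  moreover have "map_poly (pd j) (P * Q) = map_poly (pd j) P * Q + P * map_poly (pd j) Q" for P Q :: "'k bipoly poly"
    by (rule poly_eqI) (simp add: coeff_map_poly coeff_mult pd_sum pd_mult sum.distrib)
  ultimately show "derivation_along (grade wa wx) (\<lambda>p :: 'k bipoly. map_poly (pd j) (grade wa wx p))"
    by (simp add: derivation_along_def ring_homD[OF grade_hom])
qed (simp_all add: map_poly_monom monom_0[symmetric] mult_monom ring_homD[OF grade_hom])

lemma graded_pd:
  fixes p :: "'k::idom bipoly"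
  assumes "graded wa wx s p" "wa j = 0"
  shows "graded wa wx s (pd j p)"
proof (rule graded_monomD)
  have "grade wa wx (pd j p) = map_poly (pd j) (grade wa wx p)"
    using grade_pd[of wa j wx p] assms(2) by (simp add: monom_0)
  then show "grade wa wx (pd j p) = monom (pd j p) s"
    using assms(1) by (simp add: graded_def map_poly_monom)
qed

lemma degree_grade_pd:
  fixes p :: "'k::idom bipoly"
  assumes "pd j p \<noteq> 0"
  shows "degree (grade wa wx (pd j p)) + wa j \<le> degree (grade wa wx p)"
proof -
  have "wa j + degree (grade wa wx (pd j p)) = degree (monom 1 (wa j) * grade wa wx (pd j p))"
    using assms by (subst degree_mult_eq) (auto simp: degree_monom_eq)
  also have "\<dots> \<le> degree (grade wa wx p)"
    unfolding grade_pd by (rule map_poly_degree_leq) 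
  finally show ?thesis by simp
qed

subsection \<open>The generic plane\<close>

lemma pvar_nonzero: "pvar i \<noteq> (0 :: ('n, 'c::comm_ring_1) mpoly)"
  unfolding pvar_def by (metis lookup_single_eq lookup_zero zero_neq_one)

lemma four_cases_nonzero: "(j::4) \<noteq> 0 \<longleftrightarrow> j \<in> {1, 2, 3}"
  using exhaust_4_zero[of j] by auto

definition hyp :: "'k::comm_ring_1 bipoly"
  where "hyp = pvar 0 - (\<Sum>j\<in>{1,2,3}. par j * pvar j)"

text \<open>Restriction to the plane, kept as an endomorphism: each class modulo \<open>hyp\<close>
  gets its representative free of x0, so congruences between x0-free elements become
  equalities.\<close>

definition proj :: "'k bipoly \<Rightarrow> 'k::comm_ring_1 bipoly"
  where "proj = bieval bconst par (\<lambda>i. if i = 0 then \<Sum>j\<in>{1,2,3}. par j * pvar j else pvar i)"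

lemma proj_hom: "comm_ring_hom proj"
  unfolding proj_def by (rule bieval_hom[OF bconst_hom])

lemma proj_simps [simp]:
  "proj (bconst z) = bconst z" "proj (par i) = par i"
  "proj (pvar i) = (if i = 0 then \<Sum>j\<in>{1,2,3}. par j * pvar j else pvar i)"
  unfolding proj_def by (simp_all only: bieval_simps bconst_hom)

text \<open>Congruence modulo \<open>d\<close> respects sums and products, so it is enough to
  compare the identity and \<open>h\<close> on the variables.\<close>

lemma hom_dvd_diff:
  fixes h :: "'k::comm_ring_1 bipoly \<Rightarrow> 'k bipoly"
  assumes h: "comm_ring_hom h" "\<And>z. h (bconst z) = bconst z" "\<And>i. h (par i) = par i"
    and "\<And>i. d dvd pvar i - h (pvar i)"
  shows "d dvd p - h p"
proof (induction p rule: mpoly_induct2)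
  case (add p q)
  have "p + q - h (p + q) = (p - h p) + (q - h q)" by (simp add: ring_homD[OF h(1)])
  then show ?case using add by (simp only: dvd_add)
next
  case (mult p q)
  have "p * q - h (p * q) = (p - h p) * q + h p * (q - h q)"
    by (simp add: ring_homD[OF h(1)] algebra_simps)
  then show ?case using mult by (simp only: dvd_add dvd_mult dvd_mult2)
qed (use assms in simp_all)

lemma hyp_dvd_iff:
  fixes p :: "'k::comm_ring_1 bipoly"
  shows "hyp dvd p \<longleftrightarrow> proj p = 0"
proof
  have "proj (hyp :: 'k bipoly) = 0" by (simp add: hyp_def ring_homD[OF proj_hom])
  then show "proj p = 0" if "hyp dvd p" using that by (auto simp: dvd_def ring_homD[OF proj_hom])
  have "hyp dvd p - proj p"
    by (rule hom_dvd_diff[OF proj_hom]) (simp_all add: hyp_def)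
  then show "hyp dvd p" if "proj p = 0" using that by simp
qed

lemma hyp_nonzero: "hyp \<noteq> (0 :: 'k::comm_ring_1 bipoly)"
proof
  assume "hyp = (0 :: 'k bipoly)"
  then have "bieval (\<lambda>c. c) (\<lambda>_. 0) (\<lambda>_. 1) (hyp :: 'k bipoly) = 0"
    by (simp add: ring_homD[OF bieval_hom[OF ring_hom_id]])
  then show False
    by (simp add: hyp_def ring_homD[OF bieval_hom[OF ring_hom_id]] ring_hom_id)
qed

lemma pd_hyp: "j \<noteq> 0 \<Longrightarrow> pd j hyp = - pvar j"
  unfolding four_cases_nonzero by (auto simp: hyp_def pd_diff pd_add pd_mult)

lemma graded_hyp: "graded (\<lambda>_. 0) (\<lambda>_. 1) 1 (hyp :: 'k::comm_ring_1 bipoly)"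
proof -
  have v: "graded (\<lambda>_. 0) (\<lambda>_. 1) 1 (pvar j :: 'k bipoly)" for j
    using graded_pvar[of "\<lambda>_. 0" "\<lambda>_. 1" j] .
  have "graded (\<lambda>_. 0) (\<lambda>_. 1) (0 + 1) (par j * pvar j :: 'k bipoly)" for j
    using graded_mult[OF graded_par[of "\<lambda>_. 0" "\<lambda>_. 1" j] v] .
  with v[of 0] show ?thesis by (simp add: hyp_def graded_diff graded_add)
qed

abbreviation x0_free :: "'k::comm_ring_1 bipoly \<Rightarrow> bool"
  where "x0_free \<equiv> graded (\<lambda>_. 0) (\<lambda>i. if i = 0 then 1 else 0) 0"

abbreviation x_graded :: "nat \<Rightarrow> 'k::comm_ring_1 bipoly \<Rightarrow> bool"
  where "x_graded \<equiv> graded (\<lambda>_. 0) (\<lambda>_. 1)"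

lemma x0_free_proj:
  assumes "x0_free p"
  shows "proj p = p"
proof -
  let ?g = "grade (\<lambda>_. 0) (\<lambda>i::4. if i = 0 then 1 else 0)"
  \<comment> \<open>Evaluating this grading at 0 sets x0 to 0, and \<open>proj\<close> fixes
    whatever no longer contains x0.\<close>
  have "proj (poly (?g q) 0) = poly (?g q) 0" for q
    by (rule hom_eqI2[OF ring_hom_comp[OF proj_hom ring_hom_comp[OF poly_eval_is_hom grade_hom]]
        ring_hom_comp[OF poly_eval_is_hom grade_hom]])
      (simp_all add: poly_monom ring_homD[OF proj_hom])
  from this[of p] show ?thesis using assms by (simp add: graded_def poly_monom)
qed

lemma x0_free_mult: "x0_free p \<Longrightarrow> x0_free q \<Longrightarrow> x0_free (p * q)"
  using graded_mult[of _ _ 0 p 0 q] by simp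

lemma x0_free_pvar: "j \<noteq> 0 \<Longrightarrow> x0_free (pvar j)"
  using graded_pvar[of "\<lambda>_. 0" "\<lambda>i::4. if i = 0 then 1 else 0" j] by simp

lemma graded_pconst:
  fixes z :: "(4, 'k::comm_ring_1) mpoly"
  shows "graded (\<lambda>_. 0) wx 0 (pconst z)"
proof -
  have "grade (\<lambda>_. 0) wx (pconst z) = [:pconst z:]"
    by (rule hom_eqI[OF ring_hom_comp[OF grade_hom pconst_hom] const_poly_hom[OF pconst_hom]])
      (simp_all add: monom_0)
  then show ?thesis by (simp add: graded_def monom_0)
qed

lemma hyp_dvd_x0_free: "hyp dvd p \<Longrightarrow> x0_free p \<Longrightarrow> p = 0"
  using hyp_dvd_iff x0_free_proj by metis

lemma coeff_x_grade_0: "\<exists>z. coeff (grade (\<lambda>_. 0) (\<lambda>_. 1) p) 0 = pconst z"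
proof -
  have "poly (grade (\<lambda>_. 0) (\<lambda>_. 1) p) 0 = pconst (peval (\<lambda>z. z) (\<lambda>_. 0) p)"
    by (rule hom_eqI2[OF ring_hom_comp[OF poly_eval_is_hom grade_hom]
        ring_hom_comp[OF pconst_hom peval_hom[OF ring_hom_id]]])
      (simp_all add: poly_monom ring_hom_id ring_homD[OF pconst_hom])
  then show ?thesis by (auto simp: poly_0_coeff_0)
qed

text \<open>Setting the variable \<open>j\<close> to 0 detects divisibility by it and keeps the
  variable \<open>k\<close> nonzero in a domain.\<close>

lemma pvar_dvd_cancel:
  fixes p :: "'k::idom bipoly"
  assumes "pvar j dvd pvar k * p" "j \<noteq> k"
  shows "pvar j dvd p"
proof -
  define h :: "'k bipoly \<Rightarrow> 'k bipoly" where "h = bieval bconst par (\<lambda>i. if i = j then 0 else pvar i)"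
  have h: "comm_ring_hom h" unfolding h_def by (rule bieval_hom[OF bconst_hom])
  have hs: "h (bconst z) = bconst z" "h (par i) = par i" "h (pvar i) = (if i = j then 0 else pvar i)" for z i
    unfolding h_def by (simp_all only: bieval_simps bconst_hom)
  obtain q where "pvar k * p = pvar j * q" using assms(1) by (auto simp: dvd_def)
  from arg_cong[OF this, of h] have "pvar k * h p = 0"
    using assms(2) by (simp only: ring_homD(2)[OF h] hs) simp
  then have "h p = 0" by (simp add: pvar_nonzero)
  moreover have "pvar j dvd p - h p" by (rule hom_dvd_diff[OF h]) (simp_all add: hs)
  ultimately show ?thesis by simp
qed

subsection \<open>Syzygies on the generic plane\<close>

lemma sum_less_4: "(\<Sum>i<4::nat. P i) = P 0 + P 1 + P 2 + P 3"
  by (simp add: eval_nat_numeral add.assoc)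

text \<open>Hodge dual of the two-form u wedge v: for \<open>i < j < 4\<close> the entry is the
  two-by-two minor on the complementary indices with its sign. Only these entries are
  meaningful.\<close>

definition dual_minor :: "(nat \<Rightarrow> 'a::comm_ring_1) \<Rightarrow> (nat \<Rightarrow> 'a) \<Rightarrow> nat \<Rightarrow> nat \<Rightarrow> 'a"
  where "dual_minor u v i j =
    (if i = 2 then u 0 * v 1 - u 1 * v 0
     else if i = 1 then (if j = 3 then u 2 * v 0 - u 0 * v 2 else u 0 * v 3 - u 3 * v 0)
     else if j = 3 then u 1 * v 2 - u 2 * v 1
     else if j = 2 then u 3 * v 1 - u 1 * v 3 else u 2 * v 3 - u 3 * v 2)"

lemma less_4_triple:
  "i < j \<Longrightarrow> j < k \<Longrightarrow> k < (4::nat) \<Longrightarrow> i = 0 \<and> j = 1 \<and> k = 2 \<or> i = 0 \<and> j = 1 \<and> k = 3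
    \<or> i = 0 \<and> j = 2 \<and> k = 3 \<or> i = 1 \<and> j = 2 \<and> k = 3"
  by auto

text \<open>Wedging the dual of u wedge v with f contracts u wedge v by f; up to sign the result has
  entries \<open>v l * A - u l * B\<close>, where A and B are the two sums divisible by
  \<open>L\<close>.\<close>

lemma dual_minor_cocycle:
  assumes "L dvd (\<Sum>i<4. u i * f i)" "L dvd (\<Sum>i<4. v i * f i)" "i < j" "j < k" "k < (4::nat)"
  shows "L dvd f i * dual_minor u v j k - f j * dual_minor u v i k + f k * dual_minor u v i j"
proof -
  let ?A = "u 0 * f 0 + u 1 * f 1 + u 2 * f 2 + u 3 * f 3"
    and ?B = "v 0 * f 0 + v 1 * f 1 + v 2 * f 2 + v 3 * f 3"
  have AB: "L dvd ?A" "L dvd ?B" using assms(1,2) unfolding sum_less_4 .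
  then have d: "L dvd v l * ?A - u l * ?B" "L dvd u l * ?B - v l * ?A" for l
    by (simp_all only: dvd_diff dvd_mult)
  from less_4_triple[OF assms(3-)] show ?thesis
  proof (elim disjE conjE)
    assume "i = 0" "j = 1" "k = 2"
    then have "f i * dual_minor u v j k - f j * dual_minor u v i k + f k * dual_minor u v i j = v 3 * ?A - u 3 * ?B"
      by (simp add: dual_minor_def algebra_simps)
    then show ?thesis using d by metis
  next
    assume "i = 0" "j = 1" "k = 3"
    then have "f i * dual_minor u v j k - f j * dual_minor u v i k + f k * dual_minor u v i j = u 2 * ?B - v 2 * ?A"
      by (simp add: dual_minor_def algebra_simps)
    then show ?thesis using d by metis
  next
    assume "i = 0" "j = 2" "k = 3"
    then have "f i * dual_minor u v j k - f j * dual_minor u v i k + f k * dual_minor u v i j = v 1 * ?A - u 1 * ?B"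
      by (simp add: dual_minor_def algebra_simps)
    then show ?thesis using d by metis
  next
    assume "i = 1" "j = 2" "k = 3"
    then have "f i * dual_minor u v j k - f j * dual_minor u v i k + f k * dual_minor u v i j = u 0 * ?B - v 0 * ?A"
      by (simp add: dual_minor_def algebra_simps)
    then show ?thesis using d by metis
  qed
qed

lemma dual_minor_eq_0_imp:
  assumes "\<And>i j. i < j \<Longrightarrow> j < 4 \<Longrightarrow> dual_minor u v i j = 0" "i < 4" "j < 4"
  shows "u i * v j = u j * v i"
proof -
  have "\<forall>i<4. \<forall>j<4. u i * v j = u j * v i"
    unfolding all_less_4
    using assms(1)[of 0 1] assms(1)[of 0 2] assms(1)[of 0 3] assms(1)[of 1 2] assms(1)[of 1 3] assms(1)[of 2 3]
    by (simp add: dual_minor_def)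
  then show ?thesis using assms by blast
qed

lemma dual_minor_combination:
  "dual_minor u (\<lambda>i. x * a i - y * b i + z * c i) i j =
    x * dual_minor u a i j - y * dual_minor u b i j + z * dual_minor u c i j"
  by (simp add: dual_minor_def algebra_simps)

section \<open>Gradients in the plane parameters\<close>

abbreviation a_wt :: "4 \<Rightarrow> nat" where "a_wt \<equiv> \<lambda>i. if i = 0 then 0 else 1"
abbreviation a_grade :: "'k bipoly \<Rightarrow> 'k::comm_ring_1 bipoly poly" where "a_grade \<equiv> grade a_wt (\<lambda>_. 0)"
abbreviation x_grade :: "'k bipoly \<Rightarrow> 'k::comm_ring_1 bipoly poly" where "x_grade \<equiv> grade (\<lambda>_. 0) (\<lambda>_. 1)"

lemma degree_a_grade_pd:
  fixes p :: "'k::idom bipoly"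
  assumes "j \<noteq> 0" "pd j p \<noteq> 0"
  shows "degree (a_grade (pd j p)) < degree (a_grade p)"
  using degree_grade_pd[OF assms(2), of a_wt "\<lambda>_. 0"] assms(1) by simp

lemma degree_a_grade_pvar_mult:
  fixes p :: "'k::idom bipoly"
  shows "degree (a_grade (pvar j * p)) = degree (a_grade p)"
proof (cases "p = 0")
  case False
  then show ?thesis
    by (simp add: ring_homD[OF grade_hom] degree_mult_eq monom_0 pvar_nonzero)
qed simp

text \<open>Coprimality of the variables 1 and 2 makes the parallel gradient a multiple
  \<open>q\<close> of (x1, x2, x3). If \<open>p\<close> is seen as a function of a1 x1 + a2 x2 + a3
  x3, then \<open>q\<close> is its derivative, and symmetry of second derivatives passes the
  hypothesis on to \<open>q\<close>.\<close>

lemma integrable_divides: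
  fixes p :: "'k::idom bipoly"
  assumes "\<And>j k. j \<noteq> 0 \<Longrightarrow> k \<noteq> 0 \<Longrightarrow> pvar k * pd j p = pvar j * pd k p"
  shows "\<exists>q. (\<forall>j. j \<noteq> 0 \<longrightarrow> pd j p = pvar j * q) \<and>
    (\<forall>j k. j \<noteq> 0 \<longrightarrow> k \<noteq> 0 \<longrightarrow> pvar k * pd j q = pvar j * pd k q)"
proof -
  have "pvar 1 dvd pvar 2 * pd 1 p" using assms[of 1 2] by simp
  then have "pvar 1 dvd pd 1 p" by (rule pvar_dvd_cancel) simp
  then obtain q where q: "pd 1 p = pvar 1 * q" by (auto simp: dvd_def)
  have pq: "pd j p = pvar j * q" if "j \<noteq> 0" for j
  proof -
    have "pvar 1 * pd j p = pvar 1 * (pvar j * q)" using assms[of 1 j] that q by (auto simp: mult_ac)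
    then show ?thesis by (simp add: pvar_nonzero)
  qed
  have "pvar k * pd j q = pvar j * pd k q" if "j \<noteq> 0" "k \<noteq> 0" for j k
    using pd_commute[of j k p] that by (simp add: pq pd_mult)
  with pq show ?thesis by blast
qed

lemma pd_hyp_power_mult:
  fixes p :: "'k::comm_ring_1 bipoly"
  assumes "j \<noteq> 0"
  shows "pd j (hyp ^ n * p) = hyp ^ n * pd j p - of_nat n * pvar j * hyp ^ (n - 1) * p"
proof (cases n)
  case (Suc m)
  show ?thesis unfolding Suc pd_mult pd_power pd_hyp[OF assms] by (simp add: algebra_simps)
qed simp

text \<open>
  Taylor expansion at \<open>hyp = 0\<close>: the exponent \<open>n\<close> is what makes the induction on the
  parameter degree work; only \<open>n = 0\<close> is used.
\<close>

lemma extend_off_hyperplane: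
  fixes p :: "'k::field_char_0 bipoly"
  assumes "\<And>j k. j \<noteq> 0 \<Longrightarrow> k \<noteq> 0 \<Longrightarrow> pvar k * pd j p = pvar j * pd k p"
  shows "\<exists>r. \<forall>j. j \<noteq> 0 \<longrightarrow>
    pd j (hyp ^ n * p + hyp ^ Suc n * r) = - (of_nat n * pvar j * hyp ^ (n - 1) * p)"
  using assms
proof (induction "degree (a_grade p)" arbitrary: p n rule: less_induct)
  case less
  from integrable_divides[OF less.prems] obtain q where
    q: "\<And>j. j \<noteq> 0 \<Longrightarrow> pd j p = pvar j * q"
    and qi: "\<And>j k. j \<noteq> 0 \<Longrightarrow> k \<noteq> 0 \<Longrightarrow> pvar k * pd j q = pvar j * pd k q" by blast
  show ?case
  proof (cases "q = 0")
    case True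
    then show ?thesis by (intro exI[of _ 0]) (simp add: pd_hyp_power_mult q)
  next
    case False
    have q1: "pd 1 p = pvar 1 * q" using q[of 1] by simp
    have "pd 1 p \<noteq> 0" using False by (simp add: q1 pvar_nonzero)
    then have "degree (a_grade q) < degree (a_grade p)"
      using degree_a_grade_pd[of 1 p] degree_a_grade_pvar_mult[of 1 q] unfolding q1 by simp
    from less.hyps[OF this qi, of "Suc n"] obtain r where
      r: "\<And>j. j \<noteq> 0 \<Longrightarrow> pd j (hyp ^ Suc n * q + hyp ^ Suc (Suc n) * r) = - (of_nat (Suc n) * pvar j * hyp ^ n * q)"
      by auto
    \<comment> \<open>The correction found for \<open>q\<close> differentiates to
      \<open>- of_nat (Suc n) * pvar j * hyp ^ n * q\<close>. Dividing by \<open>Suc n\<close>,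
      possible in characteristic zero, makes it cancel \<open>hyp ^ n * pd j p\<close>, because
      \<open>pd j p = pvar j * q\<close>.\<close>
    define c :: "'k bipoly" where "c = bconst (1 / of_nat (Suc n))"
    have c: "of_nat (Suc n) * c = 1"
    proof -
      have "of_nat (Suc n) * (1 / of_nat (Suc n)) = (1::'k)"
        by (simp del: of_nat_Suc)
      moreover have "of_nat (Suc n) * c = bconst (of_nat (Suc n) * (1 / of_nat (Suc n)))"
        unfolding c_def pconst_def by (simp add: of_nat_single mult_single)
      ultimately show ?thesis by (simp only:) (simp add: pconst_def)
    qed
    have pdc: "pd j (c * s) = c * pd j s" for j s by (simp add: c_def pd_mult)
    have "pd j (hyp ^ n * p + hyp ^ Suc n * (c * (q + hyp * r))) = - (of_nat n * pvar j * hyp ^ (n - 1) * p)"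
      if "j \<noteq> 0" for j
    proof -
      have "hyp ^ Suc n * (c * (q + hyp * r)) = c * (hyp ^ Suc n * q + hyp ^ Suc (Suc n) * r)"
        by (simp add: algebra_simps)
      then have "pd j (hyp ^ Suc n * (c * (q + hyp * r))) = - ((of_nat (Suc n) * c) * (pvar j * hyp ^ n * q))"
        by (simp only: pdc r[OF that]) (simp only: mult_ac mult_minus_right)
      then have "pd j (hyp ^ Suc n * (c * (q + hyp * r))) = - (pvar j * hyp ^ n * q)"
        unfolding c by simp
      then show ?thesis
        by (simp only: pd_add pd_hyp_power_mult[OF that, of n p] q[OF that]) (simp add: algebra_simps)
    qed
    then show ?thesis by blast
  qed
qed

text \<open>Euler's identity, checked on generators since both sides are derivations along
  \<open>a_grade\<close>. It turns vanishing partial derivatives into degree 0 in the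
  parameters.\<close>

lemma euler_a:
  fixes p :: "'k::idom bipoly"
  shows "monom 1 1 * pderiv (a_grade p) = (\<Sum>j\<in>{1,2,3}. a_grade (par j * pd j p))"
proof (rule derivation_eqI2[where h = a_grade])
  show "derivation_along a_grade (\<lambda>p :: 'k bipoly. monom 1 1 * pderiv (a_grade p))"
    by (simp add: derivation_along_def ring_homD[OF grade_hom] pderiv_add pderiv_mult algebra_simps)
  show "derivation_along a_grade (\<lambda>p :: 'k bipoly. \<Sum>j\<in>{1,2,3}. a_grade (par j * pd j p))"
    by (simp add: derivation_along_def ring_homD[OF grade_hom] pd_add pd_mult algebra_simps)
  show "monom 1 1 * pderiv (a_grade (par i :: 'k bipoly)) = (\<Sum>j\<in>{1,2,3}. a_grade (par j * pd j (par i)))" for i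
    using exhaust_4_zero[of i]
    by (elim disjE) (simp_all add: pderiv_monom mult_monom ring_homD[OF grade_hom])
qed (simp_all add: pderiv_monom pderiv_pCons ring_homD[OF grade_hom])

lemma pd_0_imp_a_graded_0:
  fixes p :: "'k::field_char_0 bipoly"
  assumes "\<And>j. j \<noteq> 0 \<Longrightarrow> pd j p = 0"
  shows "graded a_wt (\<lambda>_. 0) 0 p"
proof -
  have "monom 1 1 * pderiv (a_grade p) = 0"
    unfolding euler_a by (simp add: assms ring_homD[OF grade_hom])
  then have "pderiv (a_grade p) = 0" by simp
  then have "degree (a_grade p) = 0" by (simp add: pderiv_eq_0_iff)
  then obtain a where "a_grade p = [:a:]" by (auto elim: degree_eq_zeroE)
  then show ?thesis by (intro graded_monomD[of _ _ _ a]) (simp add: monom_0)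
qed

text \<open>Degrees in a add up over a domain and \<open>hyp\<close> has positive degree in a, so no
  nonzero multiple of it can have degree 0.\<close>

lemma hyp_dvd_a_graded_0:
  fixes p :: "'k::idom bipoly"
  assumes "hyp dvd p" "graded a_wt (\<lambda>_. 0) 0 p"
  shows "p = 0"
proof (rule ccontr)
  assume "p \<noteq> 0"
  obtain q where q: "p = hyp * q" using assms(1) by (auto simp: dvd_def)
  have "degree (a_grade (hyp :: 'k bipoly) * a_grade q) = 0"
    using assms(2) unfolding q graded_def by (simp add: ring_homD[OF grade_hom] degree_monom_eq monom_0)
  moreover have "a_grade hyp \<noteq> (0 :: 'k bipoly poly)" "a_grade q \<noteq> 0"
    using \<open>p \<noteq> 0\<close> by (auto simp: q hyp_nonzero)
  ultimately have "degree (a_grade (hyp :: 'k bipoly)) = 0" by (simp add: degree_mult_eq)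
  then have "coeff (a_grade (hyp :: 'k bipoly)) 1 = 0" by (simp add: coeff_eq_0)
  then have "(\<Sum>j\<in>{1,2,3}. par j * pvar j :: 'k bipoly) = 0"
    by (simp add: hyp_def ring_homD[OF grade_hom] mult_monom algebra_simps flip: neg_equal_0_iff_equal[of "_ + _"])
  from arg_cong[OF this, of "bieval (\<lambda>c. c) (\<lambda>_. 1) (\<lambda>i. if i = 1 then 1 else 0)"] show False
    by (simp add: ring_homD[OF bieval_hom[OF ring_hom_id]] ring_hom_id)
qed

lemma x_graded_proj:
  assumes "x_graded s p"
  shows "x_graded s (proj p)"
proof (rule graded_monomD)
  have "x_grade (proj p) = map_poly proj (x_grade p)"
    by (rule hom_eqI2[OF ring_hom_comp[OF grade_hom proj_hom] ring_hom_comp[OF map_poly_hom[OF proj_hom] grade_hom]])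
      (simp_all add: ring_homD[OF grade_hom] mult_monom map_poly_monom ring_homD[OF proj_hom] map_poly_const add_monom monom_0[symmetric])
  then show "x_grade (proj p) = monom (proj p) s"
    using assms by (simp add: graded_def map_poly_monom ring_homD[OF proj_hom])
qed

text \<open>The configuration to be refuted. The \<open>f\<close> live on the whole space and are
  constant in a, while \<open>g\<close> is the x0-free representative of a primitive syzygy on the
  generic plane.\<close>

locale saturated_syzygy =
  fixes f g :: "nat \<Rightarrow> 'k::field_char_0 bipoly" and d e :: nat
  assumes f_regular: "regular_four f"
    and f_graded: "i < 4 \<Longrightarrow> x_graded d (f i)"
    and f_pd: "i < 4 \<Longrightarrow> pd j (f i) = 0"
    and d: "2 \<le> d" "2 * e + 1 \<le> d"
    and g_saturated: "saturated 4 g"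
    and g_graded: "i < 4 \<Longrightarrow> x_graded e (g i)"
    and g_free: "i < 4 \<Longrightarrow> x0_free (g i)"
    and syz: "hyp dvd (\<Sum>i<4. g i * f i)"
begin

definition sigma :: "4 \<Rightarrow> 4 \<Rightarrow> nat \<Rightarrow> 'k bipoly"
  where "sigma j k i = pvar k * pd j (g i) - pvar j * pd k (g i)"

text \<open>Since \<open>hyp\<close> moves with a, differentiating the relation
  \<open>hyp * m\<close> leaves an extra term \<open>- pvar j * m\<close>; the antisymmetric
  combination in \<open>sigma\<close> cancels it.\<close>

lemma sigma_syz:
  assumes "j \<noteq> 0" "k \<noteq> 0"
  shows "hyp dvd (\<Sum>i<4. sigma j k i * f i)"
proof -
  obtain m where m: "(\<Sum>i<4. g i * f i) = hyp * m" using syz by (auto simp: dvd_def)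
  have pd: "(\<Sum>i<4. pd j (g i) * f i) = hyp * pd j m - pvar j * m" if "j \<noteq> 0" for j
  proof -
    have "(\<Sum>i<4. pd j (g i) * f i) = pd j (\<Sum>i<4. g i * f i)"
      unfolding pd_sum by (rule sum.cong) (simp_all add: pd_mult f_pd)
    then show ?thesis unfolding m by (simp add: pd_mult pd_hyp[OF that])
  qed
  have "(\<Sum>i<4. sigma j k i * f i) =
      pvar k * (\<Sum>i<4. pd j (g i) * f i) - pvar j * (\<Sum>i<4. pd k (g i) * f i)"
    by (simp add: sigma_def sum_less_4 algebra_simps)
  also have "\<dots> = hyp * (pvar k * pd j m - pvar j * pd k m)"
    unfolding pd[OF assms(1)] pd[OF assms(2)] by (simp add: algebra_simps)
  finally show ?thesis by simp
qed

lemma sigma_graded: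
  assumes "i < 4"
  shows "x_graded (e + 1) (sigma j k i)"
proof -
  have "x_graded (1 + e) (pvar l * pd j (g i))" for j l
    by (rule graded_mult[OF _ graded_pd[OF g_graded[OF assms]]])
      (use graded_pvar[of "\<lambda>_. 0" "\<lambda>_. 1" l] in simp_all)
  then show ?thesis unfolding sigma_def by (intro graded_diff) (simp_all add: add.commute)
qed

lemma sigma_free:
  assumes "i < 4" "j \<noteq> 0" "k \<noteq> 0"
  shows "x0_free (sigma j k i)"
  unfolding sigma_def
  by (intro graded_diff x0_free_mult x0_free_pvar graded_pd g_free) (use assms in simp_all)

lemma sigma_a_degree:
  assumes "j \<noteq> 0" "k \<noteq> 0" "sigma j k i \<noteq> 0"
  shows "degree (a_grade (sigma j k i)) < degree (a_grade (g i))"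
proof -
  have *: "degree (a_grade (pvar l * pd j (g i))) < degree (a_grade (g i)) \<or> pvar l * pd j (g i) = 0"
    if "j \<noteq> 0" for j l
    using degree_a_grade_pd[OF that, of "g i"] degree_a_grade_pvar_mult[of l "pd j (g i)"] by auto
  have "a_grade (sigma j k i) = a_grade (pvar k * pd j (g i)) - a_grade (pvar j * pd k (g i))"
    by (simp only: sigma_def ring_homD(5)[OF grade_hom])
  moreover have "degree (a_grade (pvar k * pd j (g i)) - a_grade (pvar j * pd k (g i))) < degree (a_grade (g i))"
  proof (cases "pvar k * pd j (g i) = 0 \<or> pvar j * pd k (g i) = 0")
    case True
    then show ?thesis
      using *[OF assms(1), of k] *[OF assms(2), of j] assms(3)
      unfolding sigma_def by (auto simp: ring_homD(3)[OF grade_hom])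
  next
    case False
    then show ?thesis
      using *[OF assms(1), of k] *[OF assms(2), of j] by (intro degree_diff_less) blast+
  qed
  ultimately show ?thesis by simp
qed

lemma dual_minor_graded:
  assumes "a < b" "b < 4"
  shows "x_graded (2 * e + 1) (dual_minor g (sigma j k) a b)"
proof -
  have "x_graded (e + (e + 1)) (g a * sigma j k b)" if "a < 4" "b < 4" for a b
    using that by (intro graded_mult g_graded sigma_graded)
  then have "x_graded (2 * e + 1) (g a * sigma j k b)" if "a < 4" "b < 4" for a b
    using that by (simp add: mult_2)
  then show ?thesis
    unfolding dual_minor_def by (auto intro!: graded_diff)
qed

lemma dual_minor_free:
  assumes "a < b" "b < 4" "j \<noteq> 0" "k \<noteq> 0"
  shows "x0_free (dual_minor g (sigma j k) a b)"
proof -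
  have "x0_free (g a * sigma j k b)" if "a < 4" "b < 4" for a b
    using that assms by (intro x0_free_mult g_free sigma_free)
  then show ?thesis
    unfolding dual_minor_def by (auto intro!: graded_diff)
qed

text \<open>
  The dual minor has degree \<open>2e + 1 \<le> d\<close>, so the cofactor of its Koszul representation has
  degree \<open>\<le> 0\<close> in the \<open>x\<close> variables.
\<close>

lemma dual_minor_koszul:
  assumes "j \<noteq> 0" "k \<noteq> 0"
  shows "\<exists>z. \<forall>a<4. \<forall>b<4. a < b \<longrightarrow>
    hyp dvd dual_minor g (sigma j k) a b - (f a * pconst (z b) - f b * pconst (z a))"
proof -
  let ?W = "dual_minor g (sigma j k)"
  have "\<exists>V. \<forall>a<4. \<forall>b<4. a < b \<longrightarrow> hyp dvd ?W a b - (f a * V b - f b * V a)"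
    by (rule koszul_two_forms_mod[OF f_regular hyp_nonzero])
      (rule dual_minor_cocycle[OF syz sigma_syz[OF assms]])
  then obtain V where V: "\<forall>a<4. \<forall>b<4. a < b \<longrightarrow> hyp dvd ?W a b - (f a * V b - f b * V a)"
    by blast
  have "\<forall>b. \<exists>z. coeff (x_grade (V b)) 0 = pconst z" using coeff_x_grade_0 by blast
  then obtain z0 where z0: "\<And>b. coeff (x_grade (V b)) 0 = pconst (z0 b)"
    using choice[of "\<lambda>b z. coeff (x_grade (V b)) 0 = pconst z"] by blast
  \<comment> \<open>The \<open>f\<close> have degree \<open>d\<close> in x, so in degree
    \<open>2 * e + 1\<close> only the part of \<open>V b\<close> of degree
    \<open>2 * e + 1 - d\<close> counts: the constant term if \<open>2 * e + 1 = d\<close>, and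
    nothing if \<open>2 * e + 1 < d\<close>, where truncated subtraction would wrongly select the
    constant term.\<close>
  define z where "z b = (if 2 * e + 1 < d then 0 else z0 b)" for b
  have "hyp dvd ?W a b - (f a * pconst (z b) - f b * pconst (z a))" if "a < b" "b < 4" for a b
  proof -
    have "hyp dvd ?W a b - (f a * V b - f b * V a)" using V that by simp
    then obtain u where u: "?W a b - (f a * V b - f b * V a) = hyp * u" by (rule dvdE)
    have "monom (?W a b) (2 * e + 1) - (monom (f a) d * x_grade (V b) - monom (f b) d * x_grade (V a))
        = monom hyp 1 * x_grade u"
      using arg_cong[OF u, of x_grade] dual_minor_graded[OF that, of j k] f_graded[of a] f_graded[of b]
        graded_hyp[where 'k = 'k] that unfolding graded_def
      by (simp add: ring_homD(2,5)[OF grade_hom])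
    \<comment> \<open>Passing to the component of degree \<open>2 * e + 1\<close> preserves
      divisibility because \<open>hyp\<close> is homogeneous of degree 1.\<close>
    from arg_cong[OF this, of "\<lambda>p. coeff p (2 * e + 1)"]
    have "?W a b - ((if 2 * e + 1 < d then 0 else f a * coeff (x_grade (V b)) (2 * e + 1 - d))
        - (if 2 * e + 1 < d then 0 else f b * coeff (x_grade (V a)) (2 * e + 1 - d)))
        = hyp * coeff (x_grade u) (2 * e)"
      by (auto simp: coeff_monom_mult not_less)
    moreover have "2 * e + 1 - d = 0" using d by simp
    ultimately have "?W a b - (f a * pconst (z b) - f b * pconst (z a)) = hyp * coeff (x_grade u) (2 * e)"
      by (simp add: z_def z0[simplified] ring_homD(3)[OF pconst_hom] split: if_splits)
    then show ?thesis by simp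
  qed
  then show ?thesis by blast
qed

text \<open>The identity x1 \<open>sigma 2 3\<close> - x2 \<open>sigma 1 3\<close> + x3
  \<open>sigma 1 2\<close> = 0 carries over to the dual minors. So the same combination
  \<open>V\<close> of the cofactors is killed by F on the plane and is a multiple of F there; its
  degree 1 is below \<open>d\<close>, so it vanishes. The cofactors are constant in x, hence each of
  them is 0.\<close>

lemma dual_minor_zero:
  "\<forall>a<4. \<forall>b<4. a < b \<longrightarrow> dual_minor g (sigma 1 2) a b = 0 \<and>
    dual_minor g (sigma 1 3) a b = 0 \<and> dual_minor g (sigma 2 3) a b = 0"
proof -
  obtain z12 where "\<forall>a<4. \<forall>b<4. a < b \<longrightarrow>
      hyp dvd dual_minor g (sigma 1 2) a b - (f a * pconst (z12 b) - f b * pconst (z12 a))"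
    using dual_minor_koszul[of 1 2] by auto
  then have z12: "hyp dvd dual_minor g (sigma 1 2) a b - (f a * pconst (z12 b) - f b * pconst (z12 a))"
    if "a < b" "b < 4" for a b using that by (meson less_trans)
  obtain z13 where "\<forall>a<4. \<forall>b<4. a < b \<longrightarrow>
      hyp dvd dual_minor g (sigma 1 3) a b - (f a * pconst (z13 b) - f b * pconst (z13 a))"
    using dual_minor_koszul[of 1 3] by auto
  then have z13: "hyp dvd dual_minor g (sigma 1 3) a b - (f a * pconst (z13 b) - f b * pconst (z13 a))"
    if "a < b" "b < 4" for a b using that by (meson less_trans)
  obtain z23 where "\<forall>a<4. \<forall>b<4. a < b \<longrightarrow>
      hyp dvd dual_minor g (sigma 2 3) a b - (f a * pconst (z23 b) - f b * pconst (z23 a))"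
    using dual_minor_koszul[of 2 3] by auto
  then have z23: "hyp dvd dual_minor g (sigma 2 3) a b - (f a * pconst (z23 b) - f b * pconst (z23 a))"
    if "a < b" "b < 4" for a b using that by (meson less_trans)
  define V :: "nat \<Rightarrow> 'k bipoly" where "V b = pvar 1 * pconst (z23 b) - pvar 2 * pconst (z13 b) + pvar 3 * pconst (z12 b)" for b
  have rel: "pvar 1 * sigma 2 3 i - pvar 2 * sigma 1 3 i + pvar 3 * sigma 1 2 i = 0" for i
    by (simp add: sigma_def algebra_simps)
  have "hyp dvd f a * V b - f b * V a" if "a < b" "b < 4" for a b
  proof -
    have "pvar 1 * dual_minor g (sigma 2 3) a b - pvar 2 * dual_minor g (sigma 1 3) a b
        + pvar 3 * dual_minor g (sigma 1 2) a b = 0"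
      unfolding dual_minor_combination[symmetric] rel by (simp add: dual_minor_def)
    then have "f a * V b - f b * V a =
        - (pvar 1 * (dual_minor g (sigma 2 3) a b - (f a * pconst (z23 b) - f b * pconst (z23 a)))
          - pvar 2 * (dual_minor g (sigma 1 3) a b - (f a * pconst (z13 b) - f b * pconst (z13 a)))
          + pvar 3 * (dual_minor g (sigma 1 2) a b - (f a * pconst (z12 b) - f b * pconst (z12 a))))"
      by (simp add: V_def algebra_simps)
    then show ?thesis using z12[OF that] z13[OF that] z23[OF that]
      by (simp only: dvd_minus_iff dvd_add dvd_diff dvd_mult)
  qed
  then obtain s where s: "\<And>b. b < 4 \<Longrightarrow> hyp dvd V b - s * f b"
    using koszul_one_forms_mod[OF f_regular hyp_nonzero, of V] by blast
  \<comment> \<open>In degree 1 the term \<open>s * f b\<close> contributes nothing because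
    \<open>2 <= d\<close>; what remains is an x0-free multiple of \<open>hyp\<close>.\<close>
  have V0: "V b = 0" if "b < 4" for b
  proof -
    from s[OF that] obtain u where u: "V b - s * f b = hyp * u" by (rule dvdE)
    have "x_graded (1 + 0) (pvar j * pconst z :: 'k bipoly)" for j z
      by (rule graded_mult[OF _ graded_pconst]) (use graded_pvar[of "\<lambda>_. 0" "\<lambda>_. 1" j] in simp)
    then have "x_graded 1 (V b)" unfolding V_def by (intro graded_add graded_diff) simp_all
    then have "monom (V b) 1 - monom (f b) d * x_grade s = monom hyp 1 * x_grade u"
      using arg_cong[OF u, of x_grade] f_graded[OF that] graded_hyp[where 'k = 'k] unfolding graded_def
      by (simp add: ring_homD(2,5)[OF grade_hom] mult.commute)
    from arg_cong[OF this, of "\<lambda>p. coeff p 1"] have "V b = hyp * coeff (x_grade u) 0"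
      using d(1) by (simp add: coeff_monom_mult)
    moreover have "x0_free (V b)"
      unfolding V_def by (intro graded_add graded_diff x0_free_mult x0_free_pvar graded_pconst) simp_all
    ultimately show ?thesis using hyp_dvd_x0_free by (metis dvd_triv_left)
  qed
  have "z12 b = 0 \<and> z13 b = 0 \<and> z23 b = 0" if "b < 4" for b
  proof -
    \<comment> \<open>Evaluation at the unit vector \<open>j\<close> in x reads off the coefficient
      of \<open>pvar j\<close>, which is one of the cofactors up to sign.\<close>
    have "peval (\<lambda>z. z) (\<lambda>i. if i = j then 1 else 0) (V b) = 0" for j
      using V0[OF that] by (simp add: ring_homD[OF peval_hom[OF ring_hom_id]])
    from this[of 1] this[of 2] this[of 3] show ?thesis
      by (simp add: V_def ring_homD[OF peval_hom[OF ring_hom_id]] ring_hom_id)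
  qed
  then have D: "hyp dvd dual_minor g (sigma 1 2) a b \<and> hyp dvd dual_minor g (sigma 1 3) a b
      \<and> hyp dvd dual_minor g (sigma 2 3) a b" if "a < b" "b < 4" for a b
    using z12[OF that] z13[OF that] z23[OF that] that by (simp add: ring_homD(3)[OF pconst_hom])
  have "dual_minor g (sigma j k) a b = 0"
    if "hyp dvd dual_minor g (sigma j k) a b" "a < b" "b < 4" "j \<noteq> 0" "k \<noteq> 0" for a b j k
    by (rule hyp_dvd_x0_free[OF that(1) dual_minor_free[OF that(2-)]])
  then show ?thesis using D by simp
qed

lemma sigma_zero_aux:
  assumes "j \<noteq> 0" "k \<noteq> 0" "\<And>a b. a < b \<Longrightarrow> b < 4 \<Longrightarrow> dual_minor g (sigma j k) a b = 0" "i < 4"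
  shows "sigma j k i = 0"
proof -
  have "\<exists>l. \<forall>i<4. sigma j k i = l * g i"
    by (rule saturatedD[OF g_saturated]) (rule dual_minor_eq_0_imp[OF assms(3)])
  then obtain l where l: "sigma j k i = l * g i" using assms(4) by blast
  show ?thesis
  proof (rule ccontr)
    assume nz: "sigma j k i \<noteq> 0"
    then have "l \<noteq> 0" "g i \<noteq> 0" using l by auto
    then have "degree (a_grade (sigma j k i)) = degree (a_grade l) + degree (a_grade (g i))"
      unfolding l ring_homD(2)[OF grade_hom] by (simp add: degree_mult_eq)
    then show False using sigma_a_degree[OF assms(1,2) nz] by simp
  qed
qed

lemma sigma_zero:
  assumes "j \<noteq> 0" "k \<noteq> 0" "i < 4"
  shows "sigma j k i = 0"
proof -
  have A: "sigma 1 2 i = 0" "sigma 1 3 i = 0" "sigma 2 3 i = 0"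
    using dual_minor_zero assms(3) by (auto intro!: sigma_zero_aux)
  have B: "sigma k j i = - sigma j k i" "sigma j j i = 0" for j k
    by (simp_all add: sigma_def)
  have "j \<in> {1, 2, 3}" "k \<in> {1, 2, 3}" using assms(1,2) four_cases_nonzero by blast+
  then show ?thesis
    by (elim insertE emptyE) (simp_all add: A B(2) B(1)[of 2 1] B(1)[of 3 1] B(1)[of 3 2])
qed

lemma syzygy_zero:
  assumes "i < 4"
  shows "g i = 0"
proof -
  have "\<exists>r. \<forall>j. j \<noteq> 0 \<longrightarrow> pd j (g i + hyp * r) = 0" if "i < 4" for i
    using extend_off_hyperplane[of "g i" 0] sigma_zero[OF _ _ that] by (simp add: sigma_def)
  then obtain r where r: "\<And>i j. i < 4 \<Longrightarrow> j \<noteq> 0 \<Longrightarrow> pd j (g i + hyp * r i) = 0" by metis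
  define G where "G i = g i + hyp * r i" for i
  define S where "S = (\<Sum>i<4. G i * f i)"
  have "S = (\<Sum>i<4. g i * f i) + hyp * (\<Sum>i<4. r i * f i)"
    by (simp add: S_def G_def sum.distrib sum_distrib_left algebra_simps)
  then have "hyp dvd S" using syz by simp
  moreover have "graded a_wt (\<lambda>_. 0) 0 S"
  proof (rule pd_0_imp_a_graded_0)
    show "pd j S = 0" if "j \<noteq> 0" for j
      unfolding S_def pd_sum by (rule sum.neutral) (simp add: pd_mult f_pd G_def r[OF _ that])
  qed
  \<comment> \<open>This is where the syzygy leaves the plane: being free of a, the relation modulo
    \<open>hyp\<close> holds exactly.\<close>
  ultimately have "S = 0" by (rule hyp_dvd_a_graded_0)
  then have "f 0 * G 0 + f 1 * G 1 + f 2 * G 2 + f 3 * G 3 = 0"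
    by (simp add: S_def sum_less_4 mult.commute)
  then obtain p q s t u v where G: "G 0 = p * f 1 + q * f 2 + t * f 3" "G 1 = - p * f 0 + s * f 2 + u * f 3"
    "G 2 = - q * f 0 - s * f 1 + v * f 3" "G 3 = - t * f 0 - u * f 1 - v * f 2"
    using koszul_four[OF f_regular] by metis
  have "\<forall>i<4. \<exists>c. G i = (\<Sum>j<4. c j * f j)"
    unfolding all_less_4
    apply (intro conjI)
    subgoal by (rule exI[of _ "\<lambda>j. if j = 1 then p else if j = 2 then q else if j = 3 then t else 0"]) (simp add: sum_less_4 G)
    subgoal by (rule exI[of _ "\<lambda>j. if j = 0 then - p else if j = 2 then s else if j = 3 then u else 0"]) (use G(2) in \<open>simp add: sum_less_4\<close>)
    subgoal by (rule exI[of _ "\<lambda>j. if j = 0 then - q else if j = 1 then - s else if j = 3 then v else 0"]) (use G(3) in \<open>simp add: sum_less_4\<close>)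
    subgoal by (rule exI[of _ "\<lambda>j. if j = 0 then - t else if j = 1 then - u else if j = 2 then - v else 0"]) (use G(4) in \<open>simp add: sum_less_4\<close>)
    done
  then obtain c where c: "G i = (\<Sum>j<4. c j * f j)" using assms by blast
  \<comment> \<open>Nothing is known about homogeneity of \<open>G\<close>, since \<open>r\<close>
    is arbitrary. Degrees are therefore compared after restriction, where \<open>G i\<close> becomes
    \<open>g i\<close> of degree \<open>e\<close> and the ideal of the \<open>f\<close> starts in
    degree \<open>d > e\<close>.\<close>
  have "g i = proj (G i)"
    using x0_free_proj[OF g_free[OF assms]] hyp_dvd_iff[of "hyp :: 'k bipoly"]
    by (simp add: G_def ring_homD[OF proj_hom])
  also have "\<dots> = (\<Sum>j<4. proj (f j) * proj (c j))"
    by (simp add: c ring_homD[OF proj_hom] mult.commute)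
  finally have "monom (g i) e = (\<Sum>j<4. monom (proj (f j)) d * x_grade (proj (c j)))"
    using g_graded[OF assms] x_graded_proj[OF f_graded] unfolding graded_def
    by (simp add: ring_homD[OF grade_hom])
  from arg_cong[OF this, of "\<lambda>p. coeff p e"] show ?thesis
    using d by (simp add: coeff_sum coeff_monom_mult)
qed

end

text \<open>Dividing by the content \<open>c\<close> lowers the degree to \<open>e - m\<close>,
  which keeps the bound. The content is homogeneous and free of x0, so it stays nonzero on the plane
  and can be cancelled from the relation there.\<close>

lemma generic_syzygy_zero:
  fixes f g :: "nat \<Rightarrow> 'k::field_char_0 bipoly"
  assumes f: "regular_four f" "\<And>i. i < 4 \<Longrightarrow> x_graded d (f i)" "\<And>i j. i < 4 \<Longrightarrow> pd j (f i) = 0"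
    and d: "2 \<le> d" "2 * e + 1 \<le> d"
    and g: "\<And>i. i < 4 \<Longrightarrow> x_graded e (g i)" "\<And>i. i < 4 \<Longrightarrow> x0_free (g i)"
    and syz: "hyp dvd (\<Sum>i<4. g i * f i)"
    and i: "i < 4"
  shows "g i = 0"
proof (rule ccontr)
  assume nz: "g i \<noteq> 0"
  have "has_saturation 4 g" by (rule mpoly_has_saturation[of i]) (use i nz in auto)
  then obtain c g' where
    g': "\<And>i. i < 4 \<Longrightarrow> g i = c * g' i" and sat: "saturated 4 g'"
    unfolding has_saturation_def by blast
  have c0: "c \<noteq> 0" using nz g'[OF i] by auto
  have cg: "c * g' i \<noteq> 0" "x_graded e (c * g' i)" "x0_free (c * g' i)"
    using nz g(1)[OF i] g(2)[OF i] g'[OF i] by simp_all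
  obtain m where m: "m \<le> e" "x_graded m c"
    using graded_factor[OF cg(2,1)] le_add1 by metis
  have c_free: "x0_free c"
    using graded_factor[OF cg(3,1)] by (metis add_is_0)
  have gr: "x_graded (e - m) (g' j)" if "j < 4" for j
  proof (cases "g' j = 0")
    case False
    then have "c * g' j \<noteq> 0" using c0 by simp
    moreover have "x_graded e (c * g' j)" using g(1)[OF that] g'[OF that] by simp
    ultimately obtain m' n where "m' + n = e" "x_graded m' c" "x_graded n (g' j)"
      using graded_factor by blast
    moreover have "m' = m" using graded_unique[OF \<open>x_graded m' c\<close> m(2) c0] .
    ultimately show ?thesis by (metis add_diff_cancel_left')
  qed (simp add: graded_0)
  have fr: "x0_free (g' j)" if "j < 4" for j
  proof (cases "g' j = 0")
    case False
    then have "c * g' j \<noteq> 0" using c0 by simp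
    moreover have "x0_free (c * g' j)" using g(2)[OF that] g'[OF that] by simp
    ultimately show ?thesis using graded_factor[of _ _ 0 c "g' j"] by auto
  qed (simp add: graded_0)
  have "(\<Sum>i<4. g i * f i) = c * (\<Sum>i<4. g' i * f i)"
    by (simp add: g' sum_distrib_left mult.assoc)
  then have "c * proj (\<Sum>i<4. g' i * f i) = 0"
    using syz[unfolded hyp_dvd_iff] x0_free_proj[OF c_free] by (simp add: ring_homD(2)[OF proj_hom])
  then have "hyp dvd (\<Sum>i<4. g' i * f i)" using c0 by (simp add: hyp_dvd_iff)
  then interpret saturated_syzygy f g' d "e - m"
    using f d gr fr sat by unfold_locales auto
  have "g' i = 0" by (rule syzygy_zero[OF i])
  then show False using nz g'[OF i] by simp
qed

subsection \<open>Regular sequences\<close>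

lemma regular_fourE:
  assumes "regular_four F" "i < 4" "F i * p = (\<Sum>j<i. c j * F j)"
  obtains c' where "p = (\<Sum>j<i. c' j * F j)"
  using assms(1)[unfolded regular_four_def, rule_format, OF assms(2,3)] by (elim exE)

lemma lookup_pconst_mult: "Poly_Mapping.lookup (pconst a * p) m = a * Poly_Mapping.lookup p m"
  unfolding pconst_def mult_map_scale_conv_mult[symmetric] by (simp add: map.rep_eq when_def)

text \<open>Polynomials are free over their coefficient ring with the monomials as basis, and
  \<open>pconst\<close> acts coefficientwise, so a relation splits into one relation per
  monomial.\<close>

lemma regular_pconst:
  fixes F :: "nat \<Rightarrow> 'c::comm_ring_1"
  assumes "regular_four F"
  shows "regular_four (\<lambda>i. pconst (F i) :: ('n, 'c) mpoly)"
  unfolding regular_four_def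
proof (intro allI impI)
  fix i and p :: "('n, 'c) mpoly" and c
  assume i: "i < 4" and "pconst (F i) * p = (\<Sum>j<i. c j * pconst (F j))"
  then have "Poly_Mapping.lookup (pconst (F i) * p) m = Poly_Mapping.lookup (\<Sum>j<i. pconst (F j) * c j) m" for m
    by (simp only: mult.commute)
  then have e: "F i * Poly_Mapping.lookup p m = (\<Sum>j<i. F j * Poly_Mapping.lookup (c j) m)" for m
    by (simp only: lookup_pconst_mult lookup_sum)
  have "\<forall>m. \<exists>c'. Poly_Mapping.lookup p m = (\<Sum>j<i. c' j * F j)"
  proof
    fix m
    have "F i * Poly_Mapping.lookup p m = (\<Sum>j<i. Poly_Mapping.lookup (c j) m * F j)"
      unfolding e by (rule sum.cong) (simp_all only: mult.commute)
    then show "\<exists>c'. Poly_Mapping.lookup p m = (\<Sum>j<i. c' j * F j)"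
      by (rule assms[unfolded regular_four_def, rule_format, OF i])
  qed
  from choice[OF this] obtain c' where c': "\<And>m. Poly_Mapping.lookup p m = (\<Sum>j<i. c' m j * F j)" by blast
  \<comment> \<open>Cofactors chosen separately for every monomial are reassembled over the finitely
    many monomials of \<open>p\<close>.\<close>
  define C :: "nat \<Rightarrow> ('n, 'c) mpoly"
    where "C j = (\<Sum>m\<in>Poly_Mapping.keys p. Poly_Mapping.single m (c' m j))" for j
  have "p = (\<Sum>m\<in>Poly_Mapping.keys p. Poly_Mapping.single m (Poly_Mapping.lookup p m))"
    by (rule poly_mapping_sum_single)
  also have "\<dots> = (\<Sum>m\<in>Poly_Mapping.keys p. \<Sum>j<i. Poly_Mapping.single m (c' m j) * pconst (F j))"
  proof (rule sum.cong[OF refl])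
    fix m
    have "Poly_Mapping.single m (\<Sum>j\<in>A. c' m j * F j) = (\<Sum>j\<in>A. Poly_Mapping.single m (c' m j) * pconst (F j))" for A
      by (induction A rule: infinite_finite_induct) (simp_all add: single_add pconst_def mult_single)
    then show "Poly_Mapping.single m (Poly_Mapping.lookup p m) = (\<Sum>j<i. Poly_Mapping.single m (c' m j) * pconst (F j))"
      unfolding c' .
  qed
  also have "\<dots> = (\<Sum>j<i. C j * pconst (F j))"
    unfolding C_def sum_distrib_right by (rule sum.swap)
  finally show "\<exists>c'. p = (\<Sum>j<i. c' j * pconst (F j))" by blast
qed

lemma regular_transfer:
  assumes f: "comm_ring_hom f" and h: "comm_ring_hom h"
    and hf: "\<And>x. h (f x) = x" and fh: "\<And>y. f (h y) = y"
    and F: "regular_four F"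
  shows "regular_four (\<lambda>i. f (F i))"
  unfolding regular_four_def
proof (intro allI impI)
  fix i p c assume i: "i < 4" and e: "f (F i) * p = (\<Sum>j<i. c j * f (F j))"
  from arg_cong[OF e, of h] have "F i * h p = (\<Sum>j<i. h (c j) * F j)"
    by (simp add: ring_homD[OF h] hf)
  from regular_fourE[OF F i this] obtain c' where "h p = (\<Sum>j<i. c' j * F j)" .
  from arg_cong[OF this, of f] have "p = (\<Sum>j<i. f (c' j) * f (F j))"
    by (simp add: ring_homD[OF f] fh)
  then show "\<exists>c'. p = (\<Sum>j<i. c' j * f (F j))" by (rule exI[of _ "\<lambda>j. f (c' j)"])
qed

text \<open>Extension of coefficients places the forms in the inner variables; exchanging the two
  layers moves them to the outer variables x.\<close>

lemma regular_bi_embed: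
  fixes F :: "nat \<Rightarrow> (4, 'k::comm_ring_1) mpoly"
  assumes "regular_four F"
  shows "regular_four (\<lambda>i. bi_embed (F i))"
proof -
  define swap :: "'k bipoly \<Rightarrow> 'k bipoly" where "swap = bieval bconst pvar par"
  have swap: "comm_ring_hom swap" unfolding swap_def by (rule bieval_hom[OF bconst_hom])
  have s: "swap (bconst z) = bconst z" "swap (par i) = pvar i" "swap (pvar i) = par i" for z i
    unfolding swap_def by (simp_all only: bieval_simps bconst_hom)
  have ss: "swap (swap x) = x" for x
    by (rule hom_eqI2[OF ring_hom_comp[OF swap swap] ring_hom_id]) (simp_all add: s)
  have "swap (pconst p) = bi_embed p" for p
    by (rule hom_eqI[OF ring_hom_comp[OF swap pconst_hom] bi_embed_hom]) (simp_all add: s)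
  then show ?thesis
    using regular_transfer[OF swap swap ss ss regular_pconst[OF assms]] by simp
qed

section \<open>Ideals, cosets and regular sequences in rings given by a type\<close>

lemma type_ring_simps [simp]:
  "carrier ring_of_type_algebra = UNIV" "x \<otimes>\<^bsub>ring_of_type_algebra\<^esub> y = x * y"
  "x \<oplus>\<^bsub>ring_of_type_algebra\<^esub> y = x + y" "\<zero>\<^bsub>ring_of_type_algebra\<^esub> = 0" "\<one>\<^bsub>ring_of_type_algebra\<^esub> = 1"
  by (simp_all add: ring_of_type_algebra_def)

lemma type_ring_a_inv [simp]:
  "\<ominus>\<^bsub>ring_of_type_algebra\<^esub> (x::'a::comm_ring_1) = - x"
proof -
  interpret ring "ring_of_type_algebra :: 'a ring" by (rule ring_from_type_algebra)
  show ?thesis by (rule minus_equality) simp_all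
qed

lemma type_ring_coset: "J +>\<^bsub>ring_of_type_algebra\<^esub> p = (\<lambda>i. i + p) ` J"
  by (auto simp: a_r_coset_def')

lemma type_ideal_closed:
  fixes J :: "'a::comm_ring_1 set"
  assumes "ideal J ring_of_type_algebra"
  shows "0 \<in> J" "x \<in> J \<Longrightarrow> y \<in> J \<Longrightarrow> x + y \<in> J" "x \<in> J \<Longrightarrow> - x \<in> J" "x \<in> J \<Longrightarrow> a * x \<in> J"
proof -
  note a = ideal.axioms(1)[OF assms]
  show "0 \<in> J" using additive_subgroup.zero_closed[OF a] by simp
  show "x \<in> J \<Longrightarrow> y \<in> J \<Longrightarrow> x + y \<in> J" using additive_subgroup.a_closed[OF a, of x y] by simp
  show "x \<in> J \<Longrightarrow> - x \<in> J" using ideal.I_l_closed[OF assms, of x "- 1"] by simp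
  show "x \<in> J \<Longrightarrow> a * x \<in> J" using ideal.I_l_closed[OF assms, of x a] by simp
qed

lemma type_coset_eq_iff:
  fixes J :: "'a::comm_ring_1 set"
  assumes "ideal J ring_of_type_algebra"
  shows "J +>\<^bsub>ring_of_type_algebra\<^esub> p = J +>\<^bsub>ring_of_type_algebra\<^esub> q \<longleftrightarrow> p - q \<in> J"
proof
  note J = type_ideal_closed[OF assms]
  assume "J +>\<^bsub>ring_of_type_algebra\<^esub> p = J +>\<^bsub>ring_of_type_algebra\<^esub> q"
  moreover have "p \<in> (\<lambda>i. i + p) ` J" using J(1) by force
  ultimately obtain i where "i \<in> J" "p = i + q" unfolding type_ring_coset by auto
  then show "p - q \<in> J" by simp
next
  note J = type_ideal_closed[OF assms]
  assume pq: "p - q \<in> J"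
  have "i + p \<in> (\<lambda>i. i + q) ` J" if "i \<in> J" for i
    using J(2)[OF that pq] by (force simp: algebra_simps)
  moreover have "i + q \<in> (\<lambda>i. i + p) ` J" if "i \<in> J" for i
    using J(2)[OF that J(3)[OF pq]] by (force simp: algebra_simps)
  ultimately show "J +>\<^bsub>ring_of_type_algebra\<^esub> p = J +>\<^bsub>ring_of_type_algebra\<^esub> q"
    unfolding type_ring_coset by blast
qed

lemma type_genideal:
  fixes F :: "nat \<Rightarrow> 'a::comm_ring_1"
  shows "genideal ring_of_type_algebra (F ` {..<n}) = {p. \<exists>c. p = (\<Sum>j<n. c j * F j)}"
    (is "_ = ?S")
proof
  interpret R: cring "ring_of_type_algebra :: 'a ring" by (rule cring_from_type_algebra)
  have "ideal ?S ring_of_type_algebra"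
  proof (rule idealI)
    show "subgroup ?S (add_monoid (ring_of_type_algebra :: 'a ring))"
    proof
      show "\<one>\<^bsub>add_monoid ring_of_type_algebra\<^esub> \<in> ?S" by (auto intro!: exI[of _ "\<lambda>_. 0"])
      fix x y assume "x \<in> ?S" "y \<in> ?S"
      then obtain a b where "x = (\<Sum>j<n. a j * F j)" "y = (\<Sum>j<n. b j * F j)" by auto
      then show "x \<otimes>\<^bsub>add_monoid ring_of_type_algebra\<^esub> y \<in> ?S"
        by (auto intro!: exI[of _ "\<lambda>j. a j + b j"] simp: sum.distrib distrib_right)
    next
      fix x assume "x \<in> ?S"
      then obtain a where "x = (\<Sum>j<n. a j * F j)" by auto
      then have "- x \<in> ?S" by (auto intro!: exI[of _ "\<lambda>j. - a j"] simp: sum_negf)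
      then show "inv\<^bsub>add_monoid ring_of_type_algebra\<^esub> x \<in> ?S"
        using type_ring_a_inv[of x] by (simp add: a_inv_def)
    qed simp
    fix x y assume "x \<in> ?S"
    then obtain a where "x = (\<Sum>j<n. a j * F j)" by auto
    then show "y \<otimes>\<^bsub>ring_of_type_algebra\<^esub> x \<in> ?S" "x \<otimes>\<^bsub>ring_of_type_algebra\<^esub> y \<in> ?S"
      by (auto intro!: exI[of _ "\<lambda>j. y * a j"] simp: sum_distrib_left sum_distrib_right mult_ac)
  qed (rule R.ring_axioms)
  moreover have "F ` {..<n} \<subseteq> ?S"
  proof
    fix x assume "x \<in> F ` {..<n}"
    then obtain i where "i < n" "x = F i" by auto
    then have "x = (\<Sum>j<n. (if j = i then 1 else 0) * F j)"
      by (simp add: if_distrib[of "\<lambda>c. c * _"] sum.delta cong: if_cong)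
    then show "x \<in> ?S" unfolding mem_Collect_eq by (rule exI[of _ "\<lambda>j. if j = i then 1 else 0"])
  qed
  ultimately show "genideal ring_of_type_algebra (F ` {..<n}) \<subseteq> ?S"
    by (rule R.genideal_minimal)
  have id: "ideal (genideal ring_of_type_algebra (F ` {..<n})) ring_of_type_algebra"
    by (rule R.genideal_ideal) simp
  have sub: "F ` {..<n} \<subseteq> genideal ring_of_type_algebra (F ` {..<n})"
    by (rule R.genideal_self) simp
  have "(\<Sum>j\<in>A. c j * F j) \<in> genideal ring_of_type_algebra (F ` {..<n})" if "A \<subseteq> {..<n}" for A c
    using finite_subset[OF that finite_lessThan] that
    by (induction A) (use sub type_ideal_closed[OF id] in auto)
  then show "?S \<subseteq> genideal ring_of_type_algebra (F ` {..<n})" by blast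
qed

lemma regular_sequence_imp_regular:
  fixes fs :: "'a::comm_ring_1 list"
  assumes "regular_sequence ring_of_type_algebra fs" "length fs = 4"
  shows "regular_four (\<lambda>i. fs ! i)"
  unfolding regular_four_def
proof (intro allI impI)
  interpret R: cring "ring_of_type_algebra :: 'a ring" by (rule cring_from_type_algebra)
  fix i p c assume i: "i < 4" and e: "fs ! i * p = (\<Sum>j<i. c j * fs ! j)"
  define J where "J = genideal ring_of_type_algebra (set (take i fs))"
  have set: "set (take i fs) = (\<lambda>j. fs ! j) ` {..<i}"
    using i assms(2) by (simp add: nth_image[symmetric] lessThan_atLeast0)
  have J: "J = {p. \<exists>c. p = (\<Sum>j<i. c j * fs ! j)}"
    unfolding J_def set by (rule type_genideal)
  have id: "ideal J ring_of_type_algebra" unfolding J_def by (rule R.genideal_ideal) simp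
  have reg: "\<forall>a\<in>carrier (ring_of_type_algebra Quot J).
      (J +>\<^bsub>ring_of_type_algebra\<^esub> (fs ! i)) \<otimes>\<^bsub>ring_of_type_algebra Quot J\<^esub> a = \<zero>\<^bsub>ring_of_type_algebra Quot J\<^esub>
      \<longrightarrow> a = \<zero>\<^bsub>ring_of_type_algebra Quot J\<^esub>"
    using assms i unfolding regular_sequence_def Let_def J_def by simp
  have zero: "J +>\<^bsub>ring_of_type_algebra\<^esub> q = J \<longleftrightarrow> q \<in> J" for q
    using type_coset_eq_iff[OF id, of q 0] by (simp add: type_ring_coset)
  have "(J +>\<^bsub>ring_of_type_algebra\<^esub> (fs ! i)) \<otimes>\<^bsub>ring_of_type_algebra Quot J\<^esub> (J +>\<^bsub>ring_of_type_algebra\<^esub> p)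
      = J +>\<^bsub>ring_of_type_algebra\<^esub> (fs ! i * p)"
    using ideal.rcoset_mult_add[OF id, of "fs ! i" p] by (simp add: FactRing_def)
  also have "fs ! i * p \<in> J" unfolding J using e by blast
  then have "J +>\<^bsub>ring_of_type_algebra\<^esub> (fs ! i * p) = J" unfolding zero .
  finally have "(J +>\<^bsub>ring_of_type_algebra\<^esub> (fs ! i)) \<otimes>\<^bsub>ring_of_type_algebra Quot J\<^esub> (J +>\<^bsub>ring_of_type_algebra\<^esub> p)
      = \<zero>\<^bsub>ring_of_type_algebra Quot J\<^esub>" by (simp add: FactRing_def)
  moreover have "J +>\<^bsub>ring_of_type_algebra\<^esub> p \<in> carrier (ring_of_type_algebra Quot J)"
    by (auto simp: FactRing_def A_RCOSETS_def')
  ultimately have "J +>\<^bsub>ring_of_type_algebra\<^esub> p = \<zero>\<^bsub>ring_of_type_algebra Quot J\<^esub>"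
    using reg by blast
  then have "p \<in> J" unfolding zero[symmetric] by (simp add: FactRing_def)
  then show "\<exists>c'. p = (\<Sum>j<i. c' j * fs ! j)" unfolding J by blast
qed

subsection \<open>Specialization to a general plane\<close>

text \<open>Gaussian elimination without fractions: either the vectors \<open>c j\<close> are
  dependent over the domain, or they have a left inverse up to a factor \<open>q\<close>. As with a
  nonzero maximal minor, independence persists wherever \<open>q\<close> specializes to a nonzero
  value.\<close>

lemma elimination:
  fixes c :: "'j \<Rightarrow> 'r \<Rightarrow> 'd::idom"
  assumes "finite J"
  shows "(\<exists>v. (\<exists>j\<in>J. v j \<noteq> 0) \<and> (\<forall>r. (\<Sum>j\<in>J. v j * c j r) = 0)) \<or>
    (\<exists>q N R. q \<noteq> 0 \<and> finite R \<and>
      (\<forall>j\<in>J. \<forall>j'\<in>J. (\<Sum>r\<in>R. N j r * c j' r) = (if j = j' then q else 0)))"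
  using assms
proof (induction J)
  case empty
  show ?case by (intro disjI2 exI[of _ 1] exI[of _ "\<lambda>_ _. 0"] exI[of _ "{}"]) simp
next
  case (insert x J)
  from insert.IH show ?case
  proof
    assume "\<exists>v. (\<exists>j\<in>J. v j \<noteq> 0) \<and> (\<forall>r. (\<Sum>j\<in>J. v j * c j r) = 0)"
    then obtain v j where v: "j \<in> J" "v j \<noteq> 0" "\<And>r. (\<Sum>j\<in>J. v j * c j r) = 0" by blast
    have jx: "j \<noteq> x" using v(1) insert.hyps by auto
    have "(\<Sum>j\<in>insert x J. (v(x := 0)) j * c j r) = (\<Sum>j\<in>J. v j * c j r)" for r
      using insert.hyps by (auto intro!: sum.cong)
    then have "\<forall>r. (\<Sum>j\<in>insert x J. (v(x := 0)) j * c j r) = 0" using v(3) by simp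
    moreover have "\<exists>k\<in>insert x J. (v(x := 0)) k \<noteq> 0"
      using v(1,2) jx by (intro bexI[of _ j]) auto
    ultimately show ?thesis by blast
  next
    assume "\<exists>q N R. q \<noteq> 0 \<and> finite R \<and>
      (\<forall>j\<in>J. \<forall>j'\<in>J. (\<Sum>r\<in>R. N j r * c j' r) = (if j = j' then q else 0))"
    then obtain q N R where q: "q \<noteq> 0" "finite R"
      and N: "\<And>j j'. j \<in> J \<Longrightarrow> j' \<in> J \<Longrightarrow> (\<Sum>r\<in>R. N j r * c j' r) = (if j = j' then q else 0)"
      by blast
    define h where "h j = (\<Sum>r\<in>R. N j r * c x r)" for j
    \<comment> \<open>\<open>q\<close> times \<open>c x\<close>, minus its part along the earlier
      vectors: every \<open>N j\<close> annihilates the result. If it vanishes, it is a dependency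
      with coefficient \<open>q\<close> at \<open>x\<close>.\<close>
    define c' where "c' r = q * c x r - (\<Sum>j\<in>J. h j * c j r)" for r
    show ?thesis
    proof (cases "\<forall>r. c' r = 0")
      case True
      define v where "v j = (if j = x then q else - h j)" for j
      have "(\<Sum>j\<in>insert x J. v j * c j r) = c' r" for r
      proof -
        have "(\<Sum>j\<in>J. v j * c j r) = (\<Sum>j\<in>J. - (h j * c j r))"
          using insert.hyps by (intro sum.cong) (auto simp: v_def)
        then show ?thesis using insert.hyps by (simp add: v_def c'_def sum_negf)
      qed
      then show ?thesis using True q(1) by (intro disjI1 exI[of _ v]) (auto simp: v_def)
    next
      case False
      then obtain r0 where u: "c' r0 \<noteq> 0" by blast
      define N0 where "N0 j r = (if r \<in> R then N j r else 0)" for j r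
      have N0: "(\<Sum>r\<in>insert r0 R. N0 j r * d r) = (\<Sum>r\<in>R. N j r * d r)" for j d
        by (rule sum.mono_neutral_cong_right) (use q in \<open>auto simp: N0_def\<close>)
      \<comment> \<open>The functional taking entry \<open>r0\<close> after the same projection: it
        annihilates the earlier vectors and takes the nonzero value \<open>c' r0\<close> on
        \<open>c x\<close>.\<close>
      define M where "M r = (if r = r0 then q else 0) - (\<Sum>j\<in>J. c j r0 * N0 j r)" for r
      have M: "(\<Sum>r\<in>insert r0 R. M r * d r) = q * d r0 - (\<Sum>j\<in>J. c j r0 * (\<Sum>r\<in>R. N j r * d r))" for d
      proof -
        have "(\<Sum>r\<in>insert r0 R. M r * d r) = (\<Sum>r\<in>insert r0 R. (if r = r0 then q * d r0 else 0))
            - (\<Sum>r\<in>insert r0 R. \<Sum>j\<in>J. c j r0 * (N0 j r * d r))"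
          unfolding sum_subtractf[symmetric]
          by (rule sum.cong) (auto simp: M_def left_diff_distrib sum_distrib_right mult.assoc)
        also have "(\<Sum>r\<in>insert r0 R. \<Sum>j\<in>J. c j r0 * (N0 j r * d r)) = (\<Sum>j\<in>J. c j r0 * (\<Sum>r\<in>R. N j r * d r))"
          unfolding N0[symmetric] sum_distrib_left by (rule sum.swap)
        also have "(\<Sum>r\<in>insert r0 R. (if r = r0 then q * d r0 else 0)) = q * d r0"
          using q(2) by (simp add: sum.delta)
        finally show ?thesis .
      qed
      have Mx: "(\<Sum>r\<in>insert r0 R. M r * c x r) = c' r0"
        unfolding M c'_def h_def by (simp add: mult.commute)
      have MJ: "(\<Sum>r\<in>insert r0 R. M r * c j r) = 0" if "j \<in> J" for j
      proof -
        have "(\<Sum>k\<in>J. c k r0 * (\<Sum>r\<in>R. N k r * c j r)) = (\<Sum>k\<in>J. if k = j then c j r0 * q else 0)"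
          by (rule sum.cong) (auto simp: N that)
        then show ?thesis
          unfolding M using that insert.hyps(1) by (simp add: sum.delta mult.commute)
      qed
      \<comment> \<open>Subtracting \<open>h j * M\<close> makes the old functionals vanish on
        \<open>c x\<close>; the scalings bring all diagonal values to
        \<open>q * c' r0\<close>.\<close>
      define N' where "N' j r = (if j = x then q * M r else c' r0 * N0 j r - h j * M r)" for j r
      have Nx: "(\<Sum>r\<in>insert r0 R. N' x r * d r) = q * (\<Sum>r\<in>insert r0 R. M r * d r)" for d
        by (simp add: N'_def sum_distrib_left mult.assoc)
      have Nj: "(\<Sum>r\<in>insert r0 R. N' j r * d r) =
          c' r0 * (\<Sum>r\<in>R. N j r * d r) - h j * (\<Sum>r\<in>insert r0 R. M r * d r)" if "j \<noteq> x" for j d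
        unfolding N0[symmetric] sum_distrib_left sum_subtractf[symmetric]
        using that by (simp only: N'_def if_False left_diff_distrib mult.assoc)
      have "(\<Sum>r\<in>insert r0 R. N' j r * c j' r) = (if j = j' then q * c' r0 else 0)"
        if "j \<in> insert x J" "j' \<in> insert x J" for j j'
      proof (cases "j = x")
        case True
        then show ?thesis using that Nx[of "c j'"] Mx MJ[of j'] insert.hyps(2) by auto
      next
        case False
        then show ?thesis using that Nj[OF False, of "c j'"] Mx MJ[of j'] N[of j j'] insert.hyps(2)
          by (auto simp: h_def mult.commute)
      qed
      then show ?thesis using q u
        by (intro disjI2 exI[of _ "q * c' r0"] exI[of _ N'] exI[of _ "insert r0 R"]) simp
    qed
  qed
qed

lemma graded_single:
  fixes z :: "(4, 'k::comm_ring_1) mpoly"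
  shows "graded (\<lambda>_. 0) wx (\<Sum>i\<in>UNIV. Poly_Mapping.lookup m i * wx i) (Poly_Mapping.single m z)"
proof -
  have one: "graded (\<lambda>_. 0) wx 0 (1 :: 'k bipoly)"
    using graded_pconst[of wx 1] by (simp add: ring_homD[OF pconst_hom])
  have pw: "graded (\<lambda>_. 0) wx (k * wx i) (pvar i ^ k :: 'k bipoly)" for i k
  proof (induction k)
    case (Suc k)
    show ?case using graded_mult[OF graded_pvar Suc] by simp
  qed (simp add: one)
  have "graded (\<lambda>_. 0) wx (\<Sum>i\<in>A. Poly_Mapping.lookup m i * wx i)
    (\<Prod>i\<in>A. pvar i ^ Poly_Mapping.lookup m i :: 'k bipoly)" if "finite A" for A
    using that by induction (simp_all add: one graded_mult pw)
  from graded_mult[OF graded_pconst[of wx z] this[of UNIV]] show ?thesis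
    by (simp add: single_eq_prod_pvar[of m z])
qed

lemma graded_sum:
  "(\<And>i. i \<in> A \<Longrightarrow> graded wa wx s (f i)) \<Longrightarrow> graded wa wx s (sum f A)"
  by (induction A rule: infinite_finite_induct) (auto simp: graded_0 graded_add)

section \<open>Forms on planes and specialization of the parameters\<close>

definition plane_monomials :: "nat \<Rightarrow> (4 \<Rightarrow>\<^sub>0 nat) set"
  where "plane_monomials s = {m. mdeg m = s \<and> Poly_Mapping.lookup m 0 = 0}"

lemma finite_plane_monomials: "finite (plane_monomials s)"
proof -
  have "Poly_Mapping.lookup ` plane_monomials s \<subseteq> (UNIV :: 4 set) \<rightarrow>\<^sub>E {..s}"
    unfolding plane_monomials_def mdeg_def
    by (auto intro: member_le_sum)
  moreover have "finite ((UNIV :: 4 set) \<rightarrow>\<^sub>E {..s})" by (rule finite_PiE) simp_all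
  ultimately have "finite (Poly_Mapping.lookup ` plane_monomials s)" by (rule finite_subset)
  then show ?thesis by (rule finite_imageD) (simp add: inj_on_def lookup_inject)
qed

definition restrict_plane :: "(4 \<Rightarrow> 'k) \<Rightarrow> (4, 'k) mpoly \<Rightarrow> (4, 'k::comm_ring_1) mpoly"
  where "restrict_plane a = peval pconst (\<lambda>i. if i = 0 then \<Sum>j\<in>{1,2,3}. pconst (a j) * pvar j else pvar i)"

lemma restrict_plane_hom: "comm_ring_hom (restrict_plane a)"
  unfolding restrict_plane_def by (rule peval_hom[OF pconst_hom])

lemma restrict_plane_simps [simp]:
  "restrict_plane a (pconst c) = pconst c"
  "restrict_plane a (pvar i) = (if i = 0 then \<Sum>j\<in>{1,2,3}. pconst (a j) * pvar j else pvar i)"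
  unfolding restrict_plane_def by (simp_all only: peval_pvar pconst_hom) (simp add: ring_homD[OF pconst_hom])

definition specialize :: "(4 \<Rightarrow> 'k) \<Rightarrow> 'k bipoly \<Rightarrow> (4, 'k::comm_ring_1) mpoly"
  where "specialize a = peval (\<lambda>z. pconst (peval (\<lambda>c. c) a z)) pvar"

lemma specialize_coeff_hom: "comm_ring_hom (\<lambda>z. pconst (peval (\<lambda>c. c) a z))"
  by (rule ring_hom_comp[OF pconst_hom peval_hom[OF ring_hom_id]])

lemma specialize_hom: "comm_ring_hom (specialize a)"
  unfolding specialize_def by (rule peval_hom[OF specialize_coeff_hom])

lemma specialize_simps [simp]:
  "specialize a (pconst z) = pconst (peval (\<lambda>c. c) a z)" "specialize a (pvar i) = pvar i"
  unfolding specialize_def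
  by (simp_all add: specialize_coeff_hom ring_homD(3)[OF pconst_hom] ring_homD(3)[OF peval_hom[OF ring_hom_id]])

lemma specialize_single: "specialize a (Poly_Mapping.single m z) = Poly_Mapping.single m (peval (\<lambda>c. c) a z)"
  unfolding single_eq_prod_pvar[of m]
  by (simp add: ring_homD[OF specialize_hom])

lemma lookup_specialize: "Poly_Mapping.lookup (specialize a p) m = peval (\<lambda>c. c) a (Poly_Mapping.lookup p m)"
proof (induction p rule: poly_mapping_add_induct)
  case (single n c)
  show ?case by (simp add: specialize_single lookup_single when_def ring_homD(3)[OF peval_hom[OF ring_hom_id]])
qed (simp add: ring_homD(1)[OF specialize_hom] ring_homD(1)[OF peval_hom[OF ring_hom_id]] lookup_add)

lemma specialize_proj_bi_embed: "specialize a (proj (bi_embed p)) = restrict_plane a p"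
  by (rule hom_eqI[OF ring_hom_comp[OF specialize_hom ring_hom_comp[OF proj_hom bi_embed_hom]] restrict_plane_hom])
    (simp_all add: ring_hom_id ring_homD[OF specialize_hom] ring_homD[OF peval_hom[OF ring_hom_id]])

lemma single_mult_pconst:
  "Poly_Mapping.single m z * p = pconst z * (Poly_Mapping.single m 1 * p)"
proof -
  have "Poly_Mapping.single m z = pconst z * Poly_Mapping.single m 1"
    by (simp add: pconst_def mult_single)
  then show ?thesis by (simp only: mult.assoc)
qed

text \<open>The vectors fed to \<open>elimination\<close> are the coefficient vectors of a plane
  monomial times a restricted form. A dependency among them is a syzygy polynomial in a, refuted by
  \<open>generic_syzygy_zero\<close>; otherwise the factor \<open>q\<close> is the required
  polynomial.\<close>

lemma exists_good_parameter_polynomial: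
  fixes F :: "nat \<Rightarrow> (4, 'k::field_char_0) mpoly"
  assumes F: "regular_four F" "\<And>i. i < 4 \<Longrightarrow> x_graded d (bi_embed (F i))"
    and d: "2 \<le> d" "2 * e + 1 \<le> d"
  shows "\<exists>q. q \<noteq> 0 \<and> (\<forall>a h. peval (\<lambda>c. c) a q \<noteq> 0 \<longrightarrow>
    (\<forall>i<4. Poly_Mapping.keys (h i) \<subseteq> plane_monomials e) \<longrightarrow>
    (\<Sum>i<4. h i * restrict_plane a (F i)) = 0 \<longrightarrow> (\<forall>i<4. h i = 0))"
proof -
  define P where "P i = proj (bi_embed (F i))" for i
  define J where "J = {..<4::nat} \<times> plane_monomials e"
  define c where "c = (\<lambda>(i, m) r. Poly_Mapping.lookup (Poly_Mapping.single m 1 * P i) r)"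
  have J: "finite J" unfolding J_def by (simp add: finite_plane_monomials)
  from elimination[OF J, of c] show ?thesis
  proof
    assume "\<exists>v. (\<exists>j\<in>J. v j \<noteq> 0) \<and> (\<forall>r. (\<Sum>j\<in>J. v j * c j r) = 0)"
    then obtain v j where j: "j \<in> J" "v j \<noteq> 0" and v: "\<And>r. (\<Sum>j\<in>J. v j * c j r) = 0" by blast
    define g where "g i = (\<Sum>m\<in>plane_monomials e. Poly_Mapping.single m (v (i, m)))" for i
    have gx: "x_graded e (g i)" for i
      unfolding g_def
    proof (rule graded_sum)
      fix m assume "m \<in> plane_monomials e"
      then show "x_graded e (Poly_Mapping.single m (v (i, m)))"
        using graded_single[of "\<lambda>_. 1" m "v (i, m)"] by (simp add: plane_monomials_def mdeg_def)
    qed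
    have g0: "x0_free (g i)" for i
      unfolding g_def
    proof (rule graded_sum)
      fix m assume "m \<in> plane_monomials e"
      then have s: "(\<Sum>i\<in>UNIV. Poly_Mapping.lookup m i * (if i = 0 then 1 else 0)) = 0"
        by (auto simp: plane_monomials_def)
      then show "x0_free (Poly_Mapping.single m (v (i, m)))"
        using graded_single[of "\<lambda>i. if i = 0 then 1 else 0" m "v (i, m)"] by (simp only: s)
    qed
    have "(\<Sum>i<4. g i * P i) = 0"
    proof (rule poly_mapping_eqI)
      fix r
      have "Poly_Mapping.lookup (\<Sum>i<4. g i * P i) r = (\<Sum>i<4. \<Sum>m\<in>plane_monomials e. v (i, m) * c (i, m) r)"
        by (simp add: g_def sum_distrib_right lookup_sum single_mult_pconst[of _ "v _"] lookup_pconst_mult c_def)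
      also have "\<dots> = (\<Sum>j\<in>J. v j * c j r)"
        unfolding J_def sum.cartesian_product by (rule sum.cong) auto
      finally show "Poly_Mapping.lookup (\<Sum>i<4. g i * P i) r = Poly_Mapping.lookup 0 r" by (simp add: v)
    qed
    then have "proj (\<Sum>i<4. g i * bi_embed (F i)) = 0"
      by (simp add: ring_homD[OF proj_hom] x0_free_proj[OF g0] P_def)
    then have D: "hyp dvd (\<Sum>i<4. g i * bi_embed (F i))" by (simp add: hyp_dvd_iff)
    have gz: "g i = 0" if "i < 4" for i
      by (rule generic_syzygy_zero[where g = g, OF regular_bi_embed[OF F(1)] F(2) pd_bi_embed d gx g0 D that])
    obtain i m where im: "j = (i, m)" "i < 4" "m \<in> plane_monomials e" using j(1) by (auto simp: J_def)
    have "Poly_Mapping.lookup (g i) m = v (i, m)"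
      unfolding g_def lookup_sum lookup_single when_def
      using im(3) finite_plane_monomials by (simp add: sum.delta)
    then show ?thesis using gz[OF im(2)] j(2) im(1) by simp
  next
    assume "\<exists>q N R. q \<noteq> 0 \<and> finite R \<and>
      (\<forall>j\<in>J. \<forall>j'\<in>J. (\<Sum>r\<in>R. N j r * c j' r) = (if j = j' then q else 0))"
    then obtain q N R where q: "q \<noteq> 0"
      and N: "\<And>j j'. j \<in> J \<Longrightarrow> j' \<in> J \<Longrightarrow> (\<Sum>r\<in>R. N j r * c j' r) = (if j = j' then q else 0)"
      by blast
    have "h i = 0" if a: "peval (\<lambda>c. c) a q \<noteq> 0" and h: "\<And>i. i < 4 \<Longrightarrow> Poly_Mapping.keys (h i) \<subseteq> plane_monomials e"
      and z: "(\<Sum>i<4. h i * restrict_plane a (F i)) = 0" and i: "i < 4" for a h i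
    proof -
      let ?ev = "peval (\<lambda>c. c) a"
      note ev = ring_homD[OF peval_hom[OF ring_hom_id, of a]]
      define w where "w = (\<lambda>(i, m). Poly_Mapping.lookup (h i) m)"
      have hs: "h i = (\<Sum>m\<in>plane_monomials e. Poly_Mapping.single m (w (i, m)))" if "i < 4" for i
      proof (rule poly_mapping_eqI)
        fix m
        show "Poly_Mapping.lookup (h i) m = Poly_Mapping.lookup (\<Sum>m\<in>plane_monomials e. Poly_Mapping.single m (w (i, m))) m"
          unfolding lookup_sum lookup_single when_def w_def
          using h[OF that] finite_plane_monomials by (auto simp: sum.delta in_keys_iff)
      qed
      have evc: "?ev (c (i, m) r) = Poly_Mapping.lookup (Poly_Mapping.single m 1 * restrict_plane a (F i)) r" for i m r
        by (simp add: c_def lookup_specialize[symmetric] ring_homD[OF specialize_hom] specialize_single P_def specialize_proj_bi_embed ev)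
      have rows: "(\<Sum>j\<in>J. w j * ?ev (c j r)) = 0" for r
      proof -
        have "(\<Sum>j\<in>J. w j * ?ev (c j r)) = (\<Sum>i<4. \<Sum>m\<in>plane_monomials e. w (i, m) * ?ev (c (i, m) r))"
          unfolding J_def sum.cartesian_product by (rule sum.cong) auto
        also have "\<dots> = (\<Sum>i<4. Poly_Mapping.lookup (h i * restrict_plane a (F i)) r)"
          by (rule sum.cong)
            (simp_all add: hs sum_distrib_right lookup_sum single_mult_pconst[of _ "w _"] lookup_pconst_mult evc)
        also have "\<dots> = 0" unfolding lookup_sum[symmetric] z by simp
        finally show ?thesis .
      qed
      have "w j = 0" if "j \<in> J" for j
      proof -
        \<comment> \<open>The left inverse \<open>N\<close>, specialized at \<open>a\<close>,
          isolates \<open>?ev q * w j\<close> from the specialized relations.\<close>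
        have "?ev q * w j = (\<Sum>j'\<in>J. w j' * ?ev (\<Sum>r\<in>R. N j r * c j' r))"
        proof -
          have "(\<Sum>j'\<in>J. w j' * ?ev (\<Sum>r\<in>R. N j r * c j' r)) = (\<Sum>j'\<in>J. if j' = j then ?ev q * w j else 0)"
            by (rule sum.cong) (auto simp: N[OF that] ev(3))
          then show ?thesis using that J by (simp add: sum.delta)
        qed
        also have "\<dots> = (\<Sum>r\<in>R. ?ev (N j r) * (\<Sum>j'\<in>J. w j' * ?ev (c j' r)))"
          by (subst sum_distrib_left, subst sum.swap) (simp add: ev sum_distrib_left mult_ac)
        finally show ?thesis using a by (simp add: rows)
      qed
      then show ?thesis unfolding hs[OF i] using i by (simp add: J_def)
    qed
    then show ?thesis using q by blast
  qed
qed

lemma keys_add_subset: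
  "Poly_Mapping.keys p \<subseteq> A \<Longrightarrow> Poly_Mapping.keys q \<subseteq> A \<Longrightarrow> Poly_Mapping.keys (p + q) \<subseteq> A"
  using Poly_Mapping.keys_add[of p q] by blast

lemma keys_sum_subset:
  "(\<And>i. i \<in> B \<Longrightarrow> Poly_Mapping.keys (f i) \<subseteq> A) \<Longrightarrow> Poly_Mapping.keys (sum f B) \<subseteq> A"
  by (induction B rule: infinite_finite_induct) (simp_all add: keys_add_subset)

lemma keys_mult_plane:
  assumes "Poly_Mapping.keys p \<subseteq> plane_monomials s" "Poly_Mapping.keys q \<subseteq> plane_monomials t"
  shows "Poly_Mapping.keys (p * q) \<subseteq> plane_monomials (s + t)"
proof
  fix m assume "m \<in> Poly_Mapping.keys (p * q)"
  then obtain a b where "m = a + b" "a \<in> Poly_Mapping.keys p" "b \<in> Poly_Mapping.keys q"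
    using keys_mult[of p q] by blast
  then show "m \<in> plane_monomials (s + t)"
    using assms by (auto simp: plane_monomials_def mdeg_add lookup_add)
qed

lemma keys_pconst_plane: "Poly_Mapping.keys (pconst c) \<subseteq> plane_monomials 0"
  by (simp add: pconst_def plane_monomials_def mdeg_def)

lemma mdeg_single: "mdeg (Poly_Mapping.single i n) = n"
  by (simp add: mdeg_def lookup_single when_def sum.delta)

lemma keys_pvar_plane: "j \<noteq> 0 \<Longrightarrow> Poly_Mapping.keys (pvar j) \<subseteq> plane_monomials 1"
  by (simp add: pvar_def plane_monomials_def mdeg_single lookup_single)

lemma keys_power_plane:
  fixes p :: "(4, 'k::comm_ring_1) mpoly"
  assumes "Poly_Mapping.keys p \<subseteq> plane_monomials 1"
  shows "Poly_Mapping.keys (p ^ n) \<subseteq> plane_monomials n"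
proof (induction n)
  case 0
  show ?case using keys_pconst_plane[of "1::'k"] by (simp add: ring_homD(4)[OF pconst_hom])
next
  case (Suc n)
  show ?case using keys_mult_plane[OF assms Suc] by simp
qed

lemma keys_restrict_plane:
  fixes p :: "(4, 'k::field) mpoly"
  assumes "p \<in> homog_comp (int n)"
  shows "Poly_Mapping.keys (restrict_plane a p) \<subseteq> plane_monomials n"
proof -
  have v: "Poly_Mapping.keys (restrict_plane a (pvar i)) \<subseteq> plane_monomials 1" for i
  proof (cases "i = 0")
    case True
    have "Poly_Mapping.keys (\<Sum>j\<in>{1,2,3::4}. pconst (a j) * pvar j) \<subseteq> plane_monomials (0 + 1)"
      by (intro keys_sum_subset keys_mult_plane keys_pconst_plane keys_pvar_plane)
        (auto simp: four_cases_nonzero)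
    then show ?thesis using True by simp
  next
    case False
    then show ?thesis using keys_pvar_plane[OF False] by simp
  qed
  have pr: "Poly_Mapping.keys (\<Prod>i\<in>A. restrict_plane a (pvar i) ^ Poly_Mapping.lookup m i)
      \<subseteq> plane_monomials (\<Sum>i\<in>A. Poly_Mapping.lookup m i)" if "finite A" for A m
    using that
  proof induction
    case empty
    show ?case using keys_pconst_plane[of "1::'k"] by (simp add: ring_homD(4)[OF pconst_hom])
  next
    case (insert x A)
    then show ?case using keys_mult_plane[OF keys_power_plane[OF v[of x]] insert.IH] by simp
  qed
  have s: "Poly_Mapping.keys (restrict_plane a (Poly_Mapping.single m c)) \<subseteq> plane_monomials (mdeg m)" for m c
    using keys_mult_plane[OF keys_pconst_plane[of c] pr[of UNIV m]]
    unfolding single_eq_prod_pvar[of m c] mdeg_def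
    by (simp only: ring_homD[OF restrict_plane_hom] restrict_plane_simps(1)) simp
  have "Poly_Mapping.keys (\<Sum>m\<in>Poly_Mapping.keys p. restrict_plane a (Poly_Mapping.single m (Poly_Mapping.lookup p m)))
      \<subseteq> plane_monomials n"
  proof (rule keys_sum_subset)
    fix m assume "m \<in> Poly_Mapping.keys p"
    then have "mdeg m = n" using assms by (auto simp: homog_comp_def)
    then show "Poly_Mapping.keys (restrict_plane a (Poly_Mapping.single m (Poly_Mapping.lookup p m))) \<subseteq> plane_monomials n"
      using s[of m] by simp
  qed
  then show ?thesis
    using arg_cong[OF poly_mapping_sum_single[of p], of "restrict_plane a"]
    by (simp only: ring_homD(8)[OF restrict_plane_hom])
qed

text \<open>The scaling device of \<open>grade\<close> on the original ring: the coefficients are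
  the homogeneous components.\<close>

definition hgrade :: "(4, 'k::field) mpoly \<Rightarrow> (4, 'k) mpoly poly"
  where "hgrade = peval (\<lambda>z. [:pconst z:]) (\<lambda>i. monom (pvar i) 1)"

lemma hgrade_hom: "comm_ring_hom hgrade"
  unfolding hgrade_def by (rule peval_hom[OF const_poly_hom[OF pconst_hom]])

lemma hgrade_single:
  fixes c :: "'k::field"
  shows "hgrade (Poly_Mapping.single m c) = monom (Poly_Mapping.single m c) (mdeg m)"
proof -
  have pr: "(\<Prod>i\<in>A. monom (pvar i :: (4, 'k) mpoly) 1 ^ k i) = monom (\<Prod>i\<in>A. pvar i ^ k i) (\<Sum>i\<in>A. k i)"
    for A and k :: "4 \<Rightarrow> nat"
    by (induction A rule: infinite_finite_induct) (simp_all add: monom_power mult_monom)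
  have "hgrade (Poly_Mapping.single m c) = [:pconst c:] * (\<Prod>i\<in>UNIV. monom (pvar i) 1 ^ Poly_Mapping.lookup m i)"
    unfolding hgrade_def by (rule peval_single) (simp add: ring_homD[OF pconst_hom])
  also have "(\<Prod>i\<in>UNIV. monom (pvar i :: (4, 'k) mpoly) 1 ^ Poly_Mapping.lookup m i) =
      monom (\<Prod>i\<in>UNIV. pvar i ^ Poly_Mapping.lookup m i) (mdeg m)"
    unfolding mdeg_def by (rule pr)
  finally show ?thesis by (simp add: single_eq_prod_pvar[of m c] smult_monom)
qed

lemma coeff_hgrade:
  "coeff (hgrade p) n = (\<Sum>m\<in>Poly_Mapping.keys p. if mdeg m = n then Poly_Mapping.single m (Poly_Mapping.lookup p m) else 0)"
proof -
  have "hgrade p = (\<Sum>m\<in>Poly_Mapping.keys p. hgrade (Poly_Mapping.single m (Poly_Mapping.lookup p m)))"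
    using arg_cong[OF poly_mapping_sum_single[of p], of hgrade] by (simp only: ring_homD(8)[OF hgrade_hom])
  then show ?thesis by (simp add: coeff_sum hgrade_single)
qed

lemma hgrade_homog:
  fixes p :: "(4, 'k::field) mpoly"
  assumes "p \<in> homog_comp (int n)"
  shows "hgrade p = monom p n"
proof (rule poly_eqI)
  fix k
  have d: "mdeg m = n" if "m \<in> Poly_Mapping.keys p" for m
    using assms that by (auto simp: homog_comp_def)
  have "coeff (hgrade p) k = (if n = k then \<Sum>m\<in>Poly_Mapping.keys p. Poly_Mapping.single m (Poly_Mapping.lookup p m) else 0)"
    unfolding coeff_hgrade by (auto simp: d intro!: sum.cong sum.neutral)
  then show "coeff (hgrade p) k = coeff (monom p n) k"
    unfolding poly_mapping_sum_single[of p, symmetric] by simp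
qed

lemma coeff_hgrade_homog: "coeff (hgrade (p :: (4, 'k::field) mpoly)) n \<in> homog_comp (int n)"
proof -
  have "Poly_Mapping.keys (coeff (hgrade p) n) \<subseteq> {m. mdeg m = n}"
    unfolding coeff_hgrade by (rule keys_sum_subset) simp
  then show ?thesis by (auto simp: homog_comp_def)
qed

lemma x_graded_bi_embed:
  fixes p :: "(4, 'k::field) mpoly"
  assumes "p \<in> homog_comp (int n)"
  shows "x_graded n (bi_embed p)"
proof -
  have s: "bi_embed (Poly_Mapping.single m c) = Poly_Mapping.single m (pconst c)" for m and c :: 'k
    unfolding single_eq_prod_pvar[of m] by (simp add: ring_homD[OF bi_embed_hom])
  have "bi_embed p = (\<Sum>m\<in>Poly_Mapping.keys p. Poly_Mapping.single m (pconst (Poly_Mapping.lookup p m)))"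
    using arg_cong[OF poly_mapping_sum_single[of p], of bi_embed] by (simp only: ring_homD(8)[OF bi_embed_hom] s)
  moreover have "x_graded n (Poly_Mapping.single m (pconst (Poly_Mapping.lookup p m)))" if "m \<in> Poly_Mapping.keys p" for m
  proof -
    have "mdeg m = n" using assms that by (auto simp: homog_comp_def)
    then show ?thesis
      using graded_single[of "\<lambda>_. 1" m "pconst (Poly_Mapping.lookup p m)"] by (simp add: mdeg_def)
  qed
  ultimately show ?thesis by (simp only: graded_sum)
qed

section \<open>Linear forms and the affine chart of planes\<close>

lemma single_Suc_0_eq_iff: "Poly_Mapping.single i (Suc 0) = Poly_Mapping.single j (Suc 0) \<longleftrightarrow> i = j"
  by (metis Suc_neq_Zero lookup_single_eq lookup_single_not_eq)

lemma linear_form_eq: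
  fixes L :: "('n::finite, 'k::field) mpoly"
  assumes "L \<in> homog_comp 1"
  shows "L = (\<Sum>i\<in>UNIV. pconst (linear_coeffs L i) * pvar i)"
proof (rule poly_mapping_eqI)
  fix m
  have "Poly_Mapping.lookup (\<Sum>i\<in>UNIV. pconst (linear_coeffs L i) * pvar i) m =
      (\<Sum>i\<in>UNIV. if Poly_Mapping.single i 1 = m then linear_coeffs L i else 0)"
    by (simp add: lookup_sum pvar_def pconst_def mult_single lookup_single when_def)
  also have "\<dots> = Poly_Mapping.lookup L m"
  proof (cases "mdeg m = 1")
    case True
    then have "\<exists>i\<in>UNIV. Poly_Mapping.lookup m i = Suc 0 \<and> (\<forall>j\<in>UNIV. i \<noteq> j \<longrightarrow> Poly_Mapping.lookup m j = 0)"
      using sum_eq_Suc0_iff[of UNIV "Poly_Mapping.lookup m"] by (simp add: mdeg_def)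
    then obtain i where i: "Poly_Mapping.lookup m i = 1" "\<And>j. i \<noteq> j \<Longrightarrow> Poly_Mapping.lookup m j = 0"
      by auto
    have m: "m = Poly_Mapping.single i 1"
      by (rule poly_mapping_eqI) (use i in \<open>auto simp: lookup_single when_def\<close>)
    have "Poly_Mapping.single j (1::nat) = m \<longleftrightarrow> j = i" for j
      unfolding m by (simp add: single_Suc_0_eq_iff)
    then show ?thesis by (simp add: sum.delta linear_coeffs_def m)
  next
    case False
    then have "Poly_Mapping.single i 1 \<noteq> m" for i using mdeg_single by metis
    moreover have "Poly_Mapping.lookup L m = 0"
      using False assms by (auto simp: homog_comp_def in_keys_iff)
    ultimately show ?thesis by simp
  qed
  finally show "Poly_Mapping.lookup L m = Poly_Mapping.lookup (\<Sum>i\<in>UNIV. pconst (linear_coeffs L i) * pvar i) m" by simp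
qed

lemma sum_UNIV_4: "sum f (UNIV :: 4 set) = f 0 + f 1 + f 2 + f 3"
  unfolding UNIV_4_zero by (simp add: add.assoc)

lemma prod_UNIV_4: "prod f (UNIV :: 4 set) = f 0 * f 1 * f 2 * f 3"
  unfolding UNIV_4_zero by (simp add: mult.assoc)

text \<open>
  Clears denominators in \<open>q\<close> at the affine coordinates of the plane with coefficients \<open>l\<close>; the
  unused parameter \<open>0\<close> is taken to be \<open>l 0\<close>.
\<close>

lemma homogenize_parameters:
  fixes q :: "(4, 'k::field_char_0) mpoly"
  assumes "q \<noteq> 0"
  shows "\<exists>Q :: (4, 'k) mpoly. (\<exists>l. peval (\<lambda>c. c) l Q \<noteq> 0) \<and> (\<forall>l. peval (\<lambda>c. c) l Q \<noteq> 0 \<longrightarrow>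
    l 0 \<noteq> 0 \<and> peval (\<lambda>c. c) (\<lambda>i. if i = 0 then l 0 else - l i / l 0) q \<noteq> 0)"
proof -
  define N where "N = (\<Sum>m\<in>Poly_Mapping.keys q. mdeg m)"
  define r where "r m = Poly_Mapping.lookup m 1 + Poly_Mapping.lookup m 2 + Poly_Mapping.lookup m 3" for m :: "4 \<Rightarrow>\<^sub>0 nat"
  have rN: "r m \<le> N" if "m \<in> Poly_Mapping.keys q" for m
  proof -
    have "r m \<le> mdeg m" unfolding r_def mdeg_def sum_UNIV_4 by simp
    also have "\<dots> \<le> N" unfolding N_def using that by (intro member_le_sum) simp_all
    finally show ?thesis .
  qed
  \<comment> \<open>A term of \<open>q\<close> at the point \<open>- l i / l 0\<close>, multiplied
    by \<open>l 0 ^ Suc N\<close>. Only exponents of the variables 1, 2, 3 bring denominators, and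
    \<open>Suc N\<close> instead of \<open>N\<close> leaves a positive power of \<open>l 0\<close>,
    so \<open>Q\<close> vanishes where \<open>l 0 = 0\<close>.\<close>
  define T :: "(4 \<Rightarrow>\<^sub>0 nat) \<Rightarrow> (4, 'k) mpoly" where "T m = pconst (Poly_Mapping.lookup q m) * pvar 0 ^ (Poly_Mapping.lookup m 0 + (Suc N - r m)) *
    (- pvar 1) ^ Poly_Mapping.lookup m 1 * (- pvar 2) ^ Poly_Mapping.lookup m 2 * (- pvar 3) ^ Poly_Mapping.lookup m 3"
    for m
  define Q where "Q = (\<Sum>m\<in>Poly_Mapping.keys q. T m)"
  define al where "al l = (\<lambda>i. if i = 0 then l 0 else - l i / l 0)" for l :: "4 \<Rightarrow> 'k"
  note ev = ring_homD[OF peval_hom[OF ring_hom_id]] ring_hom_id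
  have Q0: "peval (\<lambda>c. c) l Q = 0" if "l 0 = 0" for l
    unfolding Q_def ev by (rule sum.neutral) (use that rN in \<open>auto simp: T_def ev Suc_diff_le\<close>)
  have Q1: "peval (\<lambda>c. c) l Q = l 0 ^ Suc N * peval (\<lambda>c. c) (al l) q" if l: "l 0 \<noteq> 0" for l
  proof -
    have "peval (\<lambda>c. c) l (T m) = l 0 ^ Suc N * (Poly_Mapping.lookup q m * (\<Prod>i\<in>UNIV. al l i ^ Poly_Mapping.lookup m i))"
      if "m \<in> Poly_Mapping.keys q" for m
    proof -
      have "l 0 ^ Suc N = l 0 ^ (Suc N - r m) * l 0 ^ r m"
        using rN[OF that] by (simp flip: power_add)
      also have "l 0 ^ r m = l 0 ^ Poly_Mapping.lookup m 1 * l 0 ^ Poly_Mapping.lookup m 2 * l 0 ^ Poly_Mapping.lookup m 3"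
        by (simp add: r_def power_add)
      finally have E: "l 0 ^ Suc N = l 0 ^ (Suc N - r m) *
        (l 0 ^ Poly_Mapping.lookup m 1 * l 0 ^ Poly_Mapping.lookup m 2 * l 0 ^ Poly_Mapping.lookup m 3)" .
      have n: "al l 0 = l 0" "- l 1 = l 0 * al l 1" "- l 2 = l 0 * al l 2" "- l 3 = l 0 * al l 3"
        using l by (simp_all add: al_def)
      have "peval (\<lambda>c. c) l (T m) = Poly_Mapping.lookup q m * l 0 ^ (Poly_Mapping.lookup m 0 + (Suc N - r m)) *
          (- l 1) ^ Poly_Mapping.lookup m 1 * (- l 2) ^ Poly_Mapping.lookup m 2 * (- l 3) ^ Poly_Mapping.lookup m 3"
        by (simp add: T_def ev)
      then show ?thesis
        unfolding prod_UNIV_4 E n power_add by (simp only: power_mult_distrib mult_ac)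
    qed
    then have "peval (\<lambda>c. c) l Q = (\<Sum>m\<in>Poly_Mapping.keys q. l 0 ^ Suc N * (Poly_Mapping.lookup q m * (\<Prod>i\<in>UNIV. al l i ^ Poly_Mapping.lookup m i)))"
      unfolding Q_def ev by (intro sum.cong) simp_all
    then show ?thesis by (simp add: peval_def sum_distrib_left)
  qed
  \<comment> \<open>The factor \<open>pvar 0\<close> forces \<open>a 0\<close> to be nonzero, so
    that \<open>a\<close> lies in the image of \<open>al\<close>.\<close>
  have "q * pvar 0 \<noteq> 0" using assms pvar_nonzero by simp
  from mpoly_exists_nonroot[OF this] obtain a where a: "peval (\<lambda>c. c) a q \<noteq> 0" "a 0 \<noteq> 0"
    by (auto simp: ev)
  define l where "l i = (if i = 0 then a 0 else - a i * a 0)" for i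
  have "al l = a" using a(2) by (auto simp: al_def l_def fun_eq_iff)
  then have "peval (\<lambda>c. c) l Q \<noteq> 0" using Q1[of l] a by (simp add: l_def)
  moreover have "l 0 \<noteq> 0 \<and> peval (\<lambda>c. c) (al l) q \<noteq> 0" if "peval (\<lambda>c. c) l Q \<noteq> 0" for l
  proof -
    have "l 0 \<noteq> 0" using that Q0 by blast
    then show ?thesis using that by (simp add: Q1)
  qed
  ultimately show ?thesis unfolding al_def by blast
qed

lemma restrict_plane_dvd_diff:
  "pvar 0 - (\<Sum>j\<in>{1,2,3}. pconst (a j) * pvar j) dvd p - restrict_plane a p"
proof (induction p rule: mpoly_induct)
  case (add p q)
  have "p + q - restrict_plane a (p + q) = (p - restrict_plane a p) + (q - restrict_plane a q)"
    by (simp add: ring_homD[OF restrict_plane_hom])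
  then show ?case using add by (simp only: dvd_add)
next
  case (mult p q)
  have "p * q - restrict_plane a (p * q) = (p - restrict_plane a p) * q + restrict_plane a p * (q - restrict_plane a q)"
    by (simp add: ring_homD[OF restrict_plane_hom] algebra_simps)
  then show ?case using mult by (simp only: dvd_add dvd_mult dvd_mult2)
qed simp_all

theorem theorem4p9:
  fixes F1 F2 F3 F4 :: "(4, 'k::{alg_closed_field, field_char_0}) mpoly"
    and I :: "(4, 'k) mpoly set"
    and d :: nat
  assumes "d \<ge> 2"
    and "F1 \<in> homog_comp (int d)"
    and "F2 \<in> homog_comp (int d)"
    and "F3 \<in> homog_comp (int d)"
    and "F4 \<in> homog_comp (int d)"
    and "regular_sequence mpoly_ring [F1, F2, F3, F4]"
    and "I = genideal mpoly_ring {F1, F2, F3, F4}"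
  shows "for_general_linear_form (\<lambda>L :: (4, 'k) mpoly.
    \<forall>t::int. t < \<lfloor>(3 * real d + 1) / 2\<rfloor> \<longrightarrow>
      inj_on (mult_map I L) (quot_comp I (t - 1)))"
proof -
  define F where "F = (\<lambda>i. [F1, F2, F3, F4] ! i)"
  \<comment> \<open>The largest \<open>e\<close> with \<open>2 * e + 1 <= d\<close>.\<close>
  define e where "e = (d - 1) div 2"
  have F_homog: "F i \<in> homog_comp (int d)" if "i < 4" for i
  proof -
    have "\<forall>i<4. F i \<in> homog_comp (int d)" unfolding all_less_4 F_def using assms(2-5) by simp
    then show ?thesis using that by blast
  qed
  have F_reg: "regular_four F"
    unfolding F_def by (rule regular_sequence_imp_regular[OF assms(6)]) simp
  have "F ` {..<4} = {F1, F2, F3, F4}"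
    using nth_image[of 4 "[F1, F2, F3, F4]"] by (simp add: F_def lessThan_atLeast0)
  then have I: "I = {p. \<exists>c. p = (\<Sum>j<4. c j * F j)}"
    using type_genideal[of F 4] assms(7) by simp
  interpret R: cring "mpoly_ring :: (4, 'k) mpoly ring" by (rule cring_from_type_algebra)
  have idI: "ideal I mpoly_ring" unfolding assms(7) by (rule R.genideal_ideal) simp
  have ed: "2 * e + 1 \<le> d" using assms(1) by (simp add: e_def)
  obtain q where q: "q \<noteq> 0" and good: "\<And>a h i. peval (\<lambda>c. c) a q \<noteq> 0 \<Longrightarrow>
      (\<forall>i<4. Poly_Mapping.keys (h i) \<subseteq> plane_monomials e) \<Longrightarrow>
      (\<Sum>i<4. h i * restrict_plane a (F i)) = 0 \<Longrightarrow> i < 4 \<Longrightarrow> h i = 0"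
    using exists_good_parameter_polynomial[OF F_reg x_graded_bi_embed[OF F_homog] assms(1) ed] by blast
  obtain Q :: "(4, 'k) mpoly" and l0 where l0: "peval (\<lambda>c. c) l0 Q \<noteq> 0"
    and Q: "\<And>l. peval (\<lambda>c. c) l Q \<noteq> 0 \<Longrightarrow>
      l 0 \<noteq> 0 \<and> peval (\<lambda>c. c) (\<lambda>i. if i = 0 then l 0 else - l i / l 0) q \<noteq> 0"
    using homogenize_parameters[OF q] by blast
  have evQ: "mpoly_eval Q v = peval (\<lambda>c. c) v Q" for v by (simp add: mpoly_eval_def peval_def)
  define V where "V = {v. mpoly_eval Q v = 0}"
  define U where "U = {L \<in> homog_comp 1. linear_coeffs L \<notin> V}"
  have "zariski_closed V" unfolding zariski_closed_def V_def by (rule exI[of _ "{Q}"]) simp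
  then have open_U: "zariski_open_linear_forms U" unfolding zariski_open_linear_forms_def U_def by blast
  have "(\<Sum>i\<in>UNIV. Poly_Mapping.single (Poly_Mapping.single i 1) (l0 i)) \<in> U"
  proof -
    let ?L = "\<Sum>i\<in>UNIV. Poly_Mapping.single (Poly_Mapping.single i 1) (l0 i) :: (4, 'k) mpoly"
    have "Poly_Mapping.keys ?L \<subseteq> {m. mdeg m = 1}"
      by (rule keys_sum_subset) (simp add: mdeg_single)
    then have "?L \<in> homog_comp 1" by (auto simp: homog_comp_def)
    moreover have "linear_coeffs ?L = l0"
      by (rule ext) (simp add: linear_coeffs_def lookup_sum lookup_single when_def sum.delta single_Suc_0_eq_iff)
    ultimately show ?thesis unfolding U_def V_def using l0 by (simp add: evQ)
  qed
  moreover have "inj_on (mult_map I L) (quot_comp I (t - 1))"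
    if L: "L \<in> U" and t: "t < \<lfloor>(3 * real d + 1) / 2\<rfloor>" for L t
  proof (rule inj_onI)
    define l where "l = linear_coeffs L"
    \<comment> \<open>Solving \<open>L = 0\<close> for x0 gives the coefficients
      \<open>- l i / l 0\<close>; entry 0 matches the point at which \<open>Q\<close> controls
      \<open>q\<close>.\<close>
    define a where "a = (\<lambda>i. if i = 0 then l 0 else - l i / l 0)"
    have L1: "L \<in> homog_comp (int 1)" and lV: "peval (\<lambda>c. c) l Q \<noteq> 0"
      using L by (simp_all add: U_def V_def l_def evQ)
    from Q[OF lV] have l00: "l 0 \<noteq> 0" and a: "peval (\<lambda>c. c) a q \<noteq> 0" by (simp_all add: a_def)
    define y where "y = pvar 0 - (\<Sum>j\<in>{1,2,3}. pconst (a j) * pvar j :: (4, 'k) mpoly)"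
    have pc: "pconst (l 0) * pconst (a j) = (- pconst (l j) :: (4, 'k) mpoly)" if "j \<noteq> 0" for j
      using that l00 by (simp add: a_def flip: ring_homD[OF pconst_hom])
    have Ly: "L = pconst (l 0) * y"
    proof -
      have "L = (\<Sum>i\<in>UNIV. pconst (l i) * pvar i)"
        unfolding l_def using linear_form_eq[of L] L1 by simp
      then show ?thesis
        using pc[of 1] pc[of 2] pc[of 3]
        by (simp add: sum_UNIV_4 y_def right_diff_distrib distrib_left mult.assoc[symmetric])
    qed
    have y_unit: "pconst (inverse (l 0)) * L = y"
      unfolding Ly using l00 by (simp add: mult.assoc[symmetric] ring_homD(4)[OF pconst_hom] flip: ring_homD(2)[OF pconst_hom])
    have L_nz: "L \<noteq> 0"
    proof
      assume "L = 0"
      then have "l 0 = 0" by (simp add: l_def linear_coeffs_def)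
      then show False using l00 by simp
    qed
    have res_L: "restrict_plane a L = 0"
      unfolding Ly y_def by (simp add: ring_homD[OF restrict_plane_hom])
    have key: "w \<in> I" if w: "w \<in> homog_comp (t - 1)" and Lw: "L * w \<in> I" for w
    proof (cases "w = 0")
      case True
      then show ?thesis using type_ideal_closed(1)[OF idI] by simp
    next
      case False
      \<comment> \<open>A monomial of the nonzero \<open>w\<close> shows that the integer
        \<open>t - 1\<close> is a natural number.\<close>
      then obtain m where "m \<in> Poly_Mapping.keys w" by (metis all_not_in_conv keys_eq_empty)
      then have t1: "t - 1 = int (mdeg m)" using w by (simp add: homog_comp_def)
      define n where "n = mdeg m"
      have wn: "w \<in> homog_comp (int n)" using w t1 by (simp add: n_def)
      have tn: "t = int n + 1" using t1 by (simp add: n_def)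
      obtain c where c: "L * w = (\<Sum>j<4. c j * F j)" using Lw unfolding I by blast
      \<comment> \<open>Only the cofactor components of degree \<open>Suc n - d\<close> matter. The
        case \<open>Suc n < d\<close> gets 0, since truncated subtraction would pick the constant
        terms.\<close>
      define h where "h j = (if Suc n < d then 0 else coeff (hgrade (c j)) (Suc n - d))" for j
      have "monom (L * w) (Suc n) = (\<Sum>j<4. monom (F j) d * hgrade (c j))"
        using arg_cong[OF c, of hgrade] hgrade_homog[OF L1] hgrade_homog[OF wn] hgrade_homog[OF F_homog]
        by (simp add: ring_homD[OF hgrade_hom] mult_monom mult.commute)
      from arg_cong[OF this, of "\<lambda>p. coeff p (Suc n)"]
      have "L * w = (\<Sum>j<4. coeff (monom (F j) d * hgrade (c j)) (Suc n))"
        by (simp add: coeff_sum)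
      also have "\<dots> = (\<Sum>j<4. h j * F j)"
        by (rule sum.cong) (simp_all add: coeff_monom_mult h_def mult.commute[of "F _"])
      finally have Lw': "L * w = (\<Sum>j<4. h j * F j)" .
      have dn: "d \<le> Suc n"
      proof (rule ccontr)
        assume "\<not> d \<le> Suc n"
        then have "L * w = 0" unfolding Lw' by (simp add: h_def)
        then show False using False L_nz by simp
      qed
      define e' where "e' = Suc n - d"
      have h_homog: "h j \<in> homog_comp (int e')" for j
        using coeff_hgrade_homog[of "c j" e'] dn by (simp add: h_def e'_def)
      have "e' \<le> e"
      proof -
        \<comment> \<open>Strictness against the floor gives \<open>t + 1\<close> below the real
          bound; with \<open>t = n + 1\<close> and \<open>e' = t - d\<close> this is
          \<open>2 * e' + 1 <= d\<close>.\<close>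
        have "t + 1 \<le> \<lfloor>(3 * real d + 1) / 2\<rfloor>" using t by simp
        then have "real_of_int (t + 1) \<le> (3 * real d + 1) / 2" by (simp only: le_floor_iff)
        then have "2 * real n + 4 \<le> 3 * real d + 1" unfolding tn by simp
        then have "2 * n + 4 \<le> 3 * d + 1" by linarith
        then show ?thesis unfolding e_def e'_def by simp
      qed
      \<comment> \<open>Raising the degree from \<open>e'\<close> to \<open>e\<close> by a variable
        that survives restriction makes the single polynomial \<open>q\<close> applicable for every
        \<open>t\<close>.\<close>
      define k where "k j = pvar 1 ^ (e - e') * restrict_plane a (h j)" for j
      have "Poly_Mapping.keys (k j) \<subseteq> plane_monomials ((e - e') + e')" for j
        unfolding k_def
        by (intro keys_mult_plane keys_power_plane keys_pvar_plane keys_restrict_plane h_homog) simp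
      then have k_keys: "\<forall>j<4. Poly_Mapping.keys (k j) \<subseteq> plane_monomials e" using \<open>e' \<le> e\<close> by simp
      have "(\<Sum>j<4. k j * restrict_plane a (F j)) = pvar 1 ^ (e - e') * restrict_plane a (L * w)"
        unfolding Lw' by (simp add: k_def ring_homD[OF restrict_plane_hom] sum_distrib_left mult.assoc)
      also have "\<dots> = 0" by (simp add: ring_homD[OF restrict_plane_hom] res_L)
      finally have "k j = 0" if "j < 4" for j by (rule good[OF a k_keys _ that])
      then have res_h: "restrict_plane a (h j) = 0" if "j < 4" for j
        using that by (simp add: k_def pvar_nonzero)
      \<comment> \<open>A form vanishing on the plane is a multiple of \<open>y\<close>, hence of
        \<open>L\<close>; cancelling \<open>L\<close> from the relation puts \<open>w\<close> itself
        in \<open>I\<close>.\<close>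
      have "L dvd h j" if "j < 4" for j
      proof -
        have "y dvd h j" using restrict_plane_dvd_diff[of a "h j"] res_h[OF that] by (simp add: y_def)
        moreover have "L dvd y" unfolding y_unit[symmetric] by simp
        ultimately show ?thesis by (rule dvd_trans[rotated])
      qed
      then have "\<exists>h'. \<forall>j<4. h j = L * h' j" unfolding dvd_def by metis
      then obtain h' where h': "\<And>j. j < 4 \<Longrightarrow> h j = L * h' j" by blast
      have "L * w = L * (\<Sum>j<4. h' j * F j)"
        unfolding Lw' sum_distrib_left by (rule sum.cong) (simp_all add: h' mult.assoc)
      then have "w = (\<Sum>j<4. h' j * F j)" using L_nz by simp
      then show ?thesis unfolding I by blast
    qed
    fix x x' assume x: "x \<in> quot_comp I (t - 1)" "x' \<in> quot_comp I (t - 1)"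
      and eq: "mult_map I L x = mult_map I L x'"
    obtain p p' where p: "p \<in> homog_comp (t - 1)" "x = I +>\<^bsub>mpoly_ring\<^esub> p"
      and p': "p' \<in> homog_comp (t - 1)" "x' = I +>\<^bsub>mpoly_ring\<^esub> p'"
      using x by (auto simp: quot_comp_def)
    have "L * p - L * p' \<in> I"
      using eq unfolding p(2) p'(2) mult_map_coset[OF idI] type_coset_eq_iff[OF idI] .
    then have 1: "L * (p - p') \<in> I" by (simp add: right_diff_distrib)
    have 2: "p - p' \<in> homog_comp (t - 1)"
      using p(1) p'(1) keys_diff[of p p'] by (auto simp: homog_comp_def)
    have "p - p' \<in> I" by (rule key[OF 2 1])
    then show "x = x'" unfolding p(2) p'(2) type_coset_eq_iff[OF idI] .
  qed
  ultimately show ?thesis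
    unfolding for_general_linear_form_def using open_U by blast
qed

end
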